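(* Let $\Gamma$ be a countable discrete abelian group, let $X,Y$ be finite-dimensional complex Hilbert spaces, and let $\tau:\Gamma\to U(X)$ be a unitary representation. Let $h\in AP(\Gamma,X)$ and let $C:\ell^\infty(\Gamma,X)\to\ell^\infty(\Gamma,Y)$ be an intertwiner for the representations $\pi_{X,\tau}$ and $\pi_Y$. Then the following are equivalent: (i) $C(T_\tau h)=0$. (ii) $CT_\tau(\chi\otimes\hat h(\chi))=0$ for each $\chi\in\hat\Gamma$. (iii) $CT_\tau(\sigma_\lambda(h))=0$ for each $\lambda\in L$.
   Context: $\Gamma$ is written additively; $\hat\Gamma$ is its dual group of characters $\chi:\Gamma\to\mathbb{T}$; $U(X)$ is the unitary group of $X$. $\ell^\infty(\Gamma,X)$ is the Banach space of bounded functions $\Gamma\to X$ with the supremum norm. $\pi_X:\Gamma\to B(\ell^\infty(\Gamma,X))$ is $(\pi_X(\gamma)f)(\gamma')=f(\gamma'-\gamma)$, and $\pi_Y$ is defined likewise on $\ell^\infty(\Gamma,Y)$. $T_\tau$ is the isometric isomorphism of $\ell^\infty(\Gamma,X)$ given by $(T_\tau f)(\gamma)=\tau(\gamma)f(\gamma)$, and $\pi_{X,\tau}(\gamma)=T_\tau\circ\pi_X(\gamma)\circ T_\tau^{-1}$. An intertwiner for representations $\pi_1:\Gamma\to B(Z_1)$, $\pi_2:\Gamma\to B(Z_2)$ on Banach spaces is a bounded linear operator $C:Z_1\to Z_2$ with $C\circ\pi_1(\gamma)=\pi_2(\gamma)\circ C$ for all $\gamma\in\Gamma$. For $\chi\in\hat\Gamma$,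 $a\in X$, $(\chi\otimes a)(\gamma)=\chi(\gamma)a$. $AP(\Gamma,X)$ is the closure in $\ell^\infty(\Gamma,X)$ of the $X$-valued trigonometric polynomials $\gamma\mapsto\sum_{k=1}^n\chi_k(\gamma)a_k$ ($\chi_k\in\hat\Gamma$, $a_k\in X$). A Bohr-Bochner sequence for $\Gamma$ is an increasing sequence $(H_n)$ of finite non-empty subsets with $\Gamma=\bigcup_nH_n$ and $\lim_n|(\gamma+H_n)\setminus H_n|/|H_n|=0$ for each $\gamma\in\Gamma$ (such sequences exist). For $f\in AP(\Gamma,\mathbb{C})$ the mean is $M(f)=\lim_n\frac1{|H_n|}\sum_{\gamma\in H_n}f(\gamma)$. For $h\in AP(\Gamma,X)$, $\hat h(\chi)=\lim_n\frac1{|H_n|}\sum_{\gamma\in H_n}\overline{\chi(\gamma)}h(\gamma)\in X$. For $f\in AP(\Gamma,\mathbb{C})$ and $h\in AP(\Gamma,X)$, the mean convolution is $(f*h)(\gamma)=\lim_n\frac1{|H_n|}\sum_{\gamma'\in H_n}f(\gamma-\gamma')h(\gamma')$. All these limits exist and are independent of $(H_n)$. Bochner-Fejer polynomials: let $\Gamma_B$ be the Bohr compactification of $\Gamma$ (the dual group of $\hat\Gamma$ with the discrete topology), with canonical dense embedding $i_B:\Gamma\to\Gamma_B$ and normalized Haar measure $\mu$; each $f\in AP(\Gamma,\mathbb{C})$ extends uniquely to $i_B(f)\in C(\Gamma_B,\mathbb{C})$ with $f=i_B(f)\circ i_B$. Let $\mathcal{U}$ be an open neighbourhood basis of the identity in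 $\Gamma_B$. For $U\in\mathcal{U}$ choose a non-negative $g_U\in C(\Gamma_B,\mathbb{C})$ with $\mathrm{supp}(g_U)\subseteq U$ and $\int g_U\,d\mu=1$; for $\varepsilon\in(0,1)$ choose a real trigonometric polynomial within $\varepsilon$ of $g_U\circ i_B$ in supremum norm, and (adding $\varepsilon$ and normalizing if needed) obtain a trigonometric polynomial $p_{U,\varepsilon}\ge0$ with $M(p_{U,\varepsilon})=1$. Let $L=\mathcal{U}\times(0,1)$, directed by $(U_1,\varepsilon_1)\prec(U_2,\varepsilon_2)$ when $U_2\subseteq U_1$ and $\varepsilon_2\le\varepsilon_1$. The net $(p_\lambda)_{\lambda\in L}$ satisfies: $p_\lambda\ge0$; $M(p_\lambda)=1$; and $\lim_{\lambda}\sup\{i_B(p_\lambda)(x):x\notin U\}=0$ for each open neighbourhood $U$ of the identity in $\Gamma_B$. For $h\in AP(\Gamma,X)$ set $\sigma_\lambda(h)=p_\lambda*h$; if $p_\lambda=\sum_ka_k^{(\lambda)}\chi_k$ then $\sigma_\lambda(h)=\sum_ka_k^{(\lambda)}\,\chi_k\otimes\hat h(\chi_k)$. *)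

theory Defs
  imports "HOL-Probability.Probability"
begin

section \<open>Finite-dimensional complex Hilbert spaces\<close>

class scaleC =
  fixes scaleC :: "complex \<Rightarrow> 'a \<Rightarrow> 'a" (infixr \<open>*\<^sub>C\<close> 75)

class complex_normed_vector = real_normed_vector + scaleC +
  assumes scaleC_add_right: "c *\<^sub>C (x + y) = c *\<^sub>C x + c *\<^sub>C y"
    and scaleC_add_left: "(c + d) *\<^sub>C x = c *\<^sub>C x + d *\<^sub>C x"
    and scaleC_scaleC: "c *\<^sub>C (d *\<^sub>C x) = (c * d) *\<^sub>C x"
    and scaleR_scaleC: "r *\<^sub>R x = complex_of_real r *\<^sub>C x"
    and norm_scaleC: "norm (c *\<^sub>C x) = cmod c * norm x"

text \<open>The inner product is linear in its first argument. Positivity and definiteness are contained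
  in the last axiom, since the norm has these properties.\<close>

class complex_inner = complex_normed_vector +
  fixes cinner :: "'a \<Rightarrow> 'a \<Rightarrow> complex"
  assumes cinner_commute: "cinner x y = cnj (cinner y x)"
    and cinner_add_left: "cinner (x + y) z = cinner x z + cinner y z"
    and cinner_scaleC_left: "cinner (c *\<^sub>C x) y = c * cinner x y"
    and cinner_self: "cinner x x = complex_of_real ((norm x)\<^sup>2)"

class fin_dim_chilbert = complex_inner + complete_space +
  assumes finite_dim: "\<exists>B. finite B \<and> (\<forall>x. \<exists>c. x = (\<Sum>b\<in>B. c b *\<^sub>C b))"

instantiation complex :: fin_dim_chilbert
begin

definition scaleC_complex :: "complex \<Rightarrow> complex \<Rightarrow> complex"
  where "scaleC_complex c x = c * x"

definition cinner_complex :: "complex \<Rightarrow> complex \<Rightarrow> complex"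
  where "cinner_complex x y = x * cnj y"

instance
proof
  show "\<exists>B::complex set. finite B \<and> (\<forall>x. \<exists>c. x = (\<Sum>b\<in>B. c b *\<^sub>C b))"
  proof (intro exI[of _ "{1}"] conjI allI)
    fix x :: complex
    show "\<exists>c. x = (\<Sum>b\<in>{1}. c b *\<^sub>C b)"
      by (rule exI[of _ "\<lambda>_. x"]) (simp add: scaleC_complex_def)
  qed simp
  show "cinner x x = complex_of_real ((norm x)\<^sup>2)" for x :: complex
    unfolding cinner_complex_def by (rule complex_norm_square[symmetric])
qed (auto simp: scaleC_complex_def cinner_complex_def algebra_simps norm_mult scaleR_conv_of_real)

end

definition clinear_op :: "('a::complex_normed_vector \<Rightarrow> 'b::complex_normed_vector) \<Rightarrow> bool"
  where "clinear_op A \<longleftrightarrow>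
    (\<forall>x y. A (x + y) = A x + A y) \<and> (\<forall>c x. A (c *\<^sub>C x) = c *\<^sub>C A x)"

definition bounded_clinear :: "('a::complex_normed_vector \<Rightarrow> 'b::complex_normed_vector) \<Rightarrow> bool"
  where "bounded_clinear A \<longleftrightarrow> clinear_op A \<and> (\<exists>K. \<forall>x. norm (A x) \<le> norm x * K)"

typedef (overloaded) 'a unitary =
  "{A :: 'a::complex_inner \<Rightarrow> 'a.
     clinear_op A \<and> surj A \<and> (\<forall>x y. cinner (A x) (A y) = cinner x y)}"
  morphisms apply_unitary Abs_unitary
  by (rule exI[of _ "\<lambda>x. x"]) (simp add: clinear_op_def)

setup_lifting type_definition_unitary

instantiation unitary :: (complex_inner) monoid_mult
begin

lift_definition one_unitary :: "'a unitary" is "\<lambda>x. x"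
  by (simp add: clinear_op_def)

lift_definition times_unitary :: "'a unitary \<Rightarrow> 'a unitary \<Rightarrow> 'a unitary" is "\<lambda>A B. A \<circ> B"
  by (auto simp: clinear_op_def) (metis rangeI surjD)

instance
  by standard (transfer; auto)+

end

lemma norm_apply_unitary: "norm (apply_unitary A x) = norm x"
proof -
  have "cinner (apply_unitary A x) (apply_unitary A x) = cinner x x"
    by transfer auto
  then have "(norm (apply_unitary A x))\<^sup>2 = (norm x)\<^sup>2"
    unfolding cinner_self by (simp only: of_real_eq_iff)
  then show ?thesis
    by (simp add: power2_eq_iff_nonneg)
qed

definition unitary_rep :: "('g::ab_group_add \<Rightarrow> 'x::complex_inner unitary) \<Rightarrow> bool"
  where "unitary_rep \<tau> \<longleftrightarrow> (\<forall>\<gamma> \<gamma>'. \<tau> (\<gamma> + \<gamma>') = \<tau> \<gamma> * \<tau> \<gamma>')"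


section \<open>Characters and the Bohr compactification\<close>

text \<open>The dual of a discrete abelian group. The group law is pointwise multiplication of characters;
  it is written additively so that the type is of class \<^class>\<open>ab_group_add\<close>. The topology is that of
  pointwise convergence on the group.\<close>

typedef (overloaded) 'g character =
  "{\<psi> :: 'g::ab_group_add \<Rightarrow> complex.
     (\<forall>x. cmod (\<psi> x) = 1) \<and> (\<forall>x y. \<psi> (x + y) = \<psi> x * \<psi> y)}"
  morphisms char_eval Abs_character
  by (rule exI[of _ "\<lambda>_. 1"]) simp

setup_lifting type_definition_character

instantiation character :: (ab_group_add) ab_group_add
begin

lift_definition zero_character :: "'a character" is "\<lambda>_. 1"
  by simp

lift_definition plus_character :: "'a character \<Rightarrow> 'a character \<Rightarrow> 'a character"
  is "\<lambda>\<psi> \<phi> x. \<psi> x * \<phi> x"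
  by (simp add: norm_mult)

lift_definition uminus_character :: "'a character \<Rightarrow> 'a character" is "\<lambda>\<psi> x. cnj (\<psi> x)"
  by simp

definition minus_character :: "'a character \<Rightarrow> 'a character \<Rightarrow> 'a character"
  where "minus_character \<psi> \<phi> = \<psi> + - \<phi>"

instance
proof
  fix a b c :: "'a character"
  show "a + b + c = a + (b + c)" "a + b = b + a" "0 + a = a"
    by (transfer; simp add: algebra_simps)+
  show "- a + a = 0"
    by transfer (simp add: complex_norm_square[symmetric] mult.commute[of "cnj _"])
  show "a - b = a + - b"
    by (rule minus_character_def)
qed

end

instantiation character :: (ab_group_add) topological_space
begin

definition open_character :: "'a character set \<Rightarrow> bool"
  where "open_character U \<longleftrightarrow> (\<exists>V. open V \<and> U = char_eval -` V)"

instance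
proof
  show "open (UNIV :: 'a character set)"
    unfolding open_character_def by (rule exI[of _ UNIV]) simp
  show "open (S \<inter> T)" if "open S" "open T" for S T :: "'a character set"
    using that unfolding open_character_def by (metis open_Int vimage_Int)
  show "open (\<Union>K)" if K: "\<forall>S\<in>K. open S" for K :: "'a character set set"
  proof -
    obtain V where V: "\<And>S. S \<in> K \<Longrightarrow> open (V S) \<and> S = char_eval -` V S"
      using K unfolding open_character_def by metis
    have "\<Union>K = char_eval -` (\<Union>S\<in>K. V S)"
      using V by blast
    moreover have "open (\<Union>S\<in>K. V S)"
      using V by blast
    ultimately show ?thesis
      unfolding open_character_def by blast
  qed
qed

end

text \<open>The Bohr compactification is the dual of the dual with the latter made discrete; accordingly
  the topology on \<open>'g character\<close> plays no role in the outer use of the type constructor.\<close>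

type_synonym 'g bohr = "'g character character"

lift_definition bohr_embed :: "'g::ab_group_add \<Rightarrow> 'g bohr" is "\<lambda>\<gamma> \<psi>. char_eval \<psi> \<gamma>"
  by (auto simp: plus_character.rep_eq) (transfer; simp)

definition normalized_haar :: "'b::{topological_space, ab_group_add} measure \<Rightarrow> bool"
  where "normalized_haar \<mu> \<longleftrightarrow>
    prob_space \<mu> \<and> sets \<mu> = sets borel \<and>
    (\<forall>a. distr \<mu> borel (\<lambda>x. a + x) = \<mu>) \<and>
    (\<forall>A\<in>sets borel. emeasure \<mu> A = (INF U\<in>{U. open U \<and> A \<subseteq> U}. emeasure \<mu> U)) \<and>
    (\<forall>U. open U \<longrightarrow> emeasure \<mu> U = (SUP K\<in>{K. compact K \<and> K \<subseteq> U}. emeasure \<mu> K))"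

definition open_nhd_basis_0 :: "'b::{topological_space, zero} set set \<Rightarrow> bool"
  where "open_nhd_basis_0 \<U> \<longleftrightarrow>
    (\<forall>U\<in>\<U>. open U \<and> 0 \<in> U) \<and> (\<forall>V. open V \<and> 0 \<in> V \<longrightarrow> (\<exists>U\<in>\<U>. U \<subseteq> V))"


section \<open>Bounded functions and the translation representations\<close>

text \<open>On a discrete group every function is continuous, so \<open>'g \<Rightarrow>\<^sub>C 'x\<close> is the space
  of all bounded functions with the supremum norm.\<close>

setup_lifting type_definition_bcontfun

lemma bcontfun_discreteI:
  fixes f :: "'g::discrete_topology \<Rightarrow> 'x::real_normed_vector"
  assumes "\<And>\<gamma>. norm (f \<gamma>) \<le> K"
  shows "f \<in> bcontfun"
  using assms by (auto simp: bcontfun_def intro: boundedI)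

lemma bcontfun_norm_bound:
  fixes f :: "'g::topological_space \<Rightarrow> 'x::real_normed_vector"
  assumes "f \<in> bcontfun"
  obtains K where "\<And>\<gamma>. norm (f \<gamma>) \<le> K" "K \<ge> 0"
proof -
  obtain K where K: "\<And>\<gamma>. norm (f \<gamma>) \<le> K"
    using assms by (auto simp: bcontfun_def bounded_iff)
  moreover have "K \<ge> 0"
    using K norm_ge_zero order_trans by blast
  ultimately show ?thesis
    using that by blast
qed

instantiation bcontfun :: (discrete_topology, complex_normed_vector) complex_normed_vector
begin

lift_definition scaleC_bcontfun :: "complex \<Rightarrow> ('a \<Rightarrow>\<^sub>C 'b) \<Rightarrow> ('a \<Rightarrow>\<^sub>C 'b)"
  is "\<lambda>c f \<gamma>. c *\<^sub>C f \<gamma>"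
proof -
  fix c and f :: "'a \<Rightarrow> 'b"
  assume "f \<in> bcontfun"
  then obtain K where "\<And>\<gamma>. norm (f \<gamma>) \<le> K"
    using bcontfun_norm_bound by blast
  then show "(\<lambda>\<gamma>. c *\<^sub>C f \<gamma>) \<in> bcontfun"
    by (intro bcontfun_discreteI[of _ "cmod c * K"]) (simp add: norm_scaleC mult_left_mono)
qed

instance
proof
  fix c d :: complex and r :: real and x y :: "'a \<Rightarrow>\<^sub>C 'b"
  show "c *\<^sub>C (x + y) = c *\<^sub>C x + c *\<^sub>C y"
    by (rule bcontfun_eqI) (simp add: scaleC_bcontfun.rep_eq plus_bcontfun.rep_eq scaleC_add_right)
  show "(c + d) *\<^sub>C x = c *\<^sub>C x + d *\<^sub>C x"
    by (rule bcontfun_eqI) (simp add: scaleC_bcontfun.rep_eq plus_bcontfun.rep_eq scaleC_add_left)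
  show "c *\<^sub>C (d *\<^sub>C x) = (c * d) *\<^sub>C x"
    by (rule bcontfun_eqI) (simp add: scaleC_bcontfun.rep_eq scaleC_scaleC)
  show "r *\<^sub>R x = complex_of_real r *\<^sub>C x"
    by (rule bcontfun_eqI) (simp add: scaleC_bcontfun.rep_eq scaleR_bcontfun.rep_eq scaleR_scaleC)
  have le: "norm (e *\<^sub>C z) \<le> cmod e * norm z" for e and z :: "'a \<Rightarrow>\<^sub>C 'b"
    by (rule norm_bound)
      (simp add: scaleC_bcontfun.rep_eq norm_scaleC norm_bounded mult_left_mono)
  show "norm (c *\<^sub>C x) = cmod c * norm x"
  proof (cases "c = 0")
    case True
    then show ?thesis
      using le[of 0 x] by simp
  next
    case False
    have "inverse c *\<^sub>C c *\<^sub>C x = x"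
    proof (rule bcontfun_eqI)
      fix \<gamma>
      have "1 *\<^sub>C v = v" for v :: 'b
        using scaleR_scaleC[of 1 v] by simp
      then show "apply_bcontfun (inverse c *\<^sub>C c *\<^sub>C x) \<gamma> = apply_bcontfun x \<gamma>"
        using False by (simp add: scaleC_bcontfun.rep_eq scaleC_scaleC)
    qed
    then have "norm x \<le> cmod (inverse c) * norm (c *\<^sub>C x)"
      using le[of "inverse c" "c *\<^sub>C x"] by simp
    then have "cmod c * norm x \<le> norm (c *\<^sub>C x)"
      using False by (simp add: norm_inverse norm_divide field_simps)
    then show ?thesis
      using le[of c x] by simp
  qed
qed

end

lift_definition translate ::
  "'g::{ab_group_add, discrete_topology} \<Rightarrow> ('g \<Rightarrow>\<^sub>C 'x::complex_normed_vector) \<Rightarrow> ('g \<Rightarrow>\<^sub>C 'x)"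
  is "\<lambda>\<gamma> f \<gamma>'. f (\<gamma>' - \<gamma>)"
  by (auto elim!: bcontfun_norm_bound intro: bcontfun_discreteI)

lift_definition twist ::
  "('g::discrete_topology \<Rightarrow> 'x::complex_inner unitary) \<Rightarrow> ('g \<Rightarrow>\<^sub>C 'x) \<Rightarrow> ('g \<Rightarrow>\<^sub>C 'x)"
  is "\<lambda>\<tau> f \<gamma>. apply_unitary (\<tau> \<gamma>) (f \<gamma>)"
proof -
  fix \<tau> :: "'g \<Rightarrow> 'x unitary" and f :: "'g \<Rightarrow> 'x"
  assume "f \<in> bcontfun"
  then obtain K where "\<And>\<gamma>. norm (f \<gamma>) \<le> K"
    using bcontfun_norm_bound by blast
  then show "(\<lambda>\<gamma>. apply_unitary (\<tau> \<gamma>) (f \<gamma>)) \<in> bcontfun"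
    by (intro bcontfun_discreteI[of _ K]) (simp add: norm_apply_unitary)
qed

definition twisted_translate ::
  "('g::{ab_group_add, discrete_topology} \<Rightarrow> 'x::complex_inner unitary) \<Rightarrow>
    'g \<Rightarrow> ('g \<Rightarrow>\<^sub>C 'x) \<Rightarrow> ('g \<Rightarrow>\<^sub>C 'x)"
  where "twisted_translate \<tau> \<gamma> = twist \<tau> \<circ> translate \<gamma> \<circ> inv (twist \<tau>)"

definition intertwiner ::
  "('g \<Rightarrow> 'z1 \<Rightarrow> 'z1) \<Rightarrow> ('g \<Rightarrow> 'z2 \<Rightarrow> 'z2) \<Rightarrow>
    ('z1::complex_normed_vector \<Rightarrow> 'z2::complex_normed_vector) \<Rightarrow> bool"
  where "intertwiner \<pi>1 \<pi>2 C \<longleftrightarrow> bounded_clinear C \<and> (\<forall>\<gamma>. C \<circ> \<pi>1 \<gamma> = \<pi>2 \<gamma> \<circ> C)"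


section \<open>Almost periodic functions\<close>

lift_definition char_tensor ::
  "'g::{ab_group_add, discrete_topology} character \<Rightarrow> 'x::complex_normed_vector \<Rightarrow> ('g \<Rightarrow>\<^sub>C 'x)"
  (infixr \<open>\<otimes>\<^sub>c\<close> 75)
  is "\<lambda>\<psi> a \<gamma>. char_eval \<psi> \<gamma> *\<^sub>C a"
proof -
  fix \<psi> :: "'g character" and a :: 'x
  have "cmod (char_eval \<psi> \<gamma>) = 1" for \<gamma>
    using char_eval[of \<psi>] by simp
  then show "(\<lambda>\<gamma>. char_eval \<psi> \<gamma> *\<^sub>C a) \<in> bcontfun"
    by (intro bcontfun_discreteI[of _ "norm a"]) (simp add: norm_scaleC)
qed

definition trig_polys ::
  "('g::{ab_group_add, discrete_topology} \<Rightarrow>\<^sub>C 'x::complex_normed_vector) set"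
  where "trig_polys = {f. \<exists>(n::nat) \<psi> a. f = (\<Sum>k<n. \<psi> k \<otimes>\<^sub>c a k)}"

definition AP :: "('g::{ab_group_add, discrete_topology} \<Rightarrow>\<^sub>C 'x::complex_normed_vector) set"
  where "AP = closure trig_polys"

definition bohr_bochner :: "(nat \<Rightarrow> 'g::ab_group_add set) \<Rightarrow> bool"
  where "bohr_bochner H \<longleftrightarrow>
    incseq H \<and> (\<forall>n. finite (H n) \<and> H n \<noteq> {}) \<and> (\<Union>n. H n) = UNIV \<and>
    (\<forall>\<gamma>. (\<lambda>n. real (card ((+) \<gamma> ` H n - H n)) / real (card (H n))) \<longlonglongrightarrow> 0)"

text \<open>The means below are limits along a Bohr-Bochner sequence \<open>H\<close>. For almost periodic arguments
  the limits exist and do not depend on \<open>H\<close>.\<close>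

definition average :: "'g set \<Rightarrow> ('g \<Rightarrow> 'x::real_vector) \<Rightarrow> 'x"
  where "average S f = (1 / real (card S)) *\<^sub>R (\<Sum>\<gamma>\<in>S. f \<gamma>)"

definition mean :: "(nat \<Rightarrow> 'g::discrete_topology set) \<Rightarrow> ('g \<Rightarrow>\<^sub>C complex) \<Rightarrow> complex"
  where "mean H f = lim (\<lambda>n. average (H n) (apply_bcontfun f))"

definition fourier_coeff ::
  "(nat \<Rightarrow> 'g::{ab_group_add, discrete_topology} set) \<Rightarrow>
    ('g \<Rightarrow>\<^sub>C 'x::complex_normed_vector) \<Rightarrow> 'g character \<Rightarrow> 'x"
  where "fourier_coeff H h \<psi> =
    lim (\<lambda>n. average (H n) (\<lambda>\<gamma>. cnj (char_eval \<psi> \<gamma>) *\<^sub>C apply_bcontfun h \<gamma>))"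

text \<open>A bound valid also where the limit fails to exist: all such values of \<^const>\<open>lim\<close> are the
  same.\<close>

lemma norm_average_le:
  fixes f :: "'g \<Rightarrow> 'x::real_normed_vector"
  assumes "\<And>\<gamma>. norm (f \<gamma>) \<le> K" "K \<ge> 0"
  shows "norm (average S f) \<le> K"
proof (cases "card S = 0")
  case False
  have "norm (\<Sum>\<gamma>\<in>S. f \<gamma>) \<le> (\<Sum>\<gamma>\<in>S. norm (f \<gamma>))"
    by (rule norm_sum)
  also have "\<dots> \<le> real (card S) * K"
    using assms(1) by (rule sum_bounded_above)
  finally show ?thesis
    using False by (simp add: average_def field_simps)
qed (simp add: average_def assms)

lemma norm_lim_le:
  fixes X :: "nat \<Rightarrow> 'x::real_normed_vector"
  assumes "\<And>n. norm (X n) \<le> K"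
  shows "norm (lim X) \<le> max K (norm (THE x::'x. False))"
proof (cases "convergent X")
  case True
  then have "X \<longlonglongrightarrow> lim X"
    by (simp add: convergent_LIMSEQ_iff)
  then have "norm (lim X) \<le> K"
    using assms by (intro Lim_bounded[OF tendsto_norm]) auto
  then show ?thesis by simp
next
  case False
  then have "(\<lambda>L. X \<longlonglongrightarrow> L) = (\<lambda>_. False)"
    by (auto simp: convergent_def)
  then show ?thesis
    by (simp add: lim_def)
qed

lift_definition mean_conv ::
  "(nat \<Rightarrow> 'g::{ab_group_add, discrete_topology} set) \<Rightarrow>
    ('g \<Rightarrow>\<^sub>C complex) \<Rightarrow> ('g \<Rightarrow>\<^sub>C 'x::complex_normed_vector) \<Rightarrow> ('g \<Rightarrow>\<^sub>C 'x)"
  is "\<lambda>H f h \<gamma>. lim (\<lambda>n. average (H n) (\<lambda>\<gamma>'. f (\<gamma> - \<gamma>') *\<^sub>C h \<gamma>'))"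
proof -
  fix H :: "nat \<Rightarrow> 'g set" and f :: "'g \<Rightarrow> complex" and h :: "'g \<Rightarrow> 'x"
  assume "f \<in> bcontfun" "h \<in> bcontfun"
  then obtain K M where K: "\<And>\<gamma>. norm (f \<gamma>) \<le> K" "K \<ge> 0"
    and M: "\<And>\<gamma>. norm (h \<gamma>) \<le> M" "M \<ge> 0"
    by (metis bcontfun_norm_bound)
  have "norm (f (\<gamma> - \<gamma>') *\<^sub>C h \<gamma>') \<le> K * M" for \<gamma> \<gamma>'
    using K M by (simp add: norm_scaleC mult_mono)
  then have "norm (average (H n) (\<lambda>\<gamma>'. f (\<gamma> - \<gamma>') *\<^sub>C h \<gamma>')) \<le> K * M" for \<gamma> n
    using K M by (intro norm_average_le) auto
  then show "(\<lambda>\<gamma>. lim (\<lambda>n. average (H n) (\<lambda>\<gamma>'. f (\<gamma> - \<gamma>') *\<^sub>C h \<gamma>'))) \<in> bcontfun"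
    by (intro bcontfun_discreteI[OF norm_lim_le])
qed


section \<open>Bochner-Fejer polynomials\<close>

text \<open>\<open>g U\<close> is the bump function supported in \<open>U\<close> and \<open>q U \<epsilon>\<close> the real trigonometric polynomial
  within \<open>\<epsilon>\<close> of it; \<open>p U \<epsilon>\<close> arises from \<open>q U \<epsilon>\<close> by possibly adding \<open>\<epsilon>\<close> (the
  summand \<open>s\<close>) and by rescaling, so as to be non-negative of mean 1.\<close>

definition bochner_fejer ::
  "(nat \<Rightarrow> 'g::{ab_group_add, discrete_topology} set) \<Rightarrow> 'g bohr measure \<Rightarrow> 'g bohr set set \<Rightarrow>
    ('g bohr set \<Rightarrow> real \<Rightarrow> ('g \<Rightarrow>\<^sub>C complex)) \<Rightarrow> bool"
  where "bochner_fejer H \<mu> \<U> p \<longleftrightarrow>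
    (\<exists>(g :: 'g bohr set \<Rightarrow> 'g bohr \<Rightarrow> real) (q :: 'g bohr set \<Rightarrow> real \<Rightarrow> ('g \<Rightarrow>\<^sub>C complex)).
      (\<forall>U\<in>\<U>. continuous_on UNIV (g U) \<and> (\<forall>x. g U x \<ge> 0) \<and>
        closure {x. g U x \<noteq> 0} \<subseteq> U \<and> (LINT x|\<mu>. g U x) = 1) \<and>
      (\<forall>U\<in>\<U>. \<forall>\<epsilon>\<in>{0<..<1}.
        q U \<epsilon> \<in> trig_polys \<and>
        (\<forall>\<gamma>. apply_bcontfun (q U \<epsilon>) \<gamma> \<in> \<real> \<and>
          cmod (apply_bcontfun (q U \<epsilon>) \<gamma> - complex_of_real (g U (bohr_embed \<gamma>))) \<le> \<epsilon>) \<and>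
        p U \<epsilon> \<in> trig_polys \<and>
        (\<forall>\<gamma>. apply_bcontfun (p U \<epsilon>) \<gamma> \<in> \<real>\<^sub>\<ge>\<^sub>0) \<and>
        mean H (p U \<epsilon>) = 1 \<and>
        (\<exists>c::real. \<exists>s\<in>{0, \<epsilon>}. \<forall>\<gamma>. apply_bcontfun (p U \<epsilon>) \<gamma> =
          complex_of_real c * (apply_bcontfun (q U \<epsilon>) \<gamma> + complex_of_real s))))"

end

(* The operator D = C o T_tau commutes with translations. Averages of translates of h, weighted by a
   conjugate character, converge in sup norm to chi tensor h^(chi), and those weighted by a trigonometric
   polynomial p converge to p * h; so D kills these limits as soon as D h = 0, respectively as soon as
   D kills all chi tensor h^(chi). Conversely some sigma_lambda(h) is arbitrarily close to h: for
   gamma in a small Bohr neighbourhood of 0 the translate of h by gamma is close to h, and elsewhere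
   p_lambda is small. The latter needs a bound on the factor normalizing p_lambda, i.e. that the mean
   of g_U over the group is its Haar integral; this equidistribution follows from Stone-Weierstrass
   on the compact Bohr group, without density of the group in it. *)

theory Submission
  imports Defs
begin

section \<open>Vectors and averages\<close>

instance fin_dim_chilbert \<subseteq> banach ..

lemma scaleC_one [simp]: "1 *\<^sub>C x = (x :: 'a::complex_normed_vector)"
  using scaleR_scaleC[of 1 x] by simp

text \<open>Real bilinearity makes the limit, zero and difference rules of
  \<open>bounded_bilinear\<close> available for complex scalars.\<close>

lemma bounded_bilinear_scaleC:
  "bounded_bilinear (scaleC :: complex \<Rightarrow> 'a::complex_normed_vector \<Rightarrow> 'a)"
proof
  fix c d :: complex and r :: real and x y :: 'a
  show "(c + d) *\<^sub>C x = c *\<^sub>C x + d *\<^sub>C x" "c *\<^sub>C (x + y) = c *\<^sub>C x + c *\<^sub>C y"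
    by (rule scaleC_add_left scaleC_add_right)+
  show "(r *\<^sub>R c) *\<^sub>C x = r *\<^sub>R c *\<^sub>C x"
    by (simp add: scaleR_scaleC[of r "c *\<^sub>C x"] scaleC_scaleC scaleR_conv_of_real)
  show "c *\<^sub>C r *\<^sub>R x = r *\<^sub>R c *\<^sub>C x"
    by (simp add: scaleR_scaleC[of r] scaleC_scaleC mult.commute)
  show "\<exists>K. \<forall>c (x::'a). norm (c *\<^sub>C x) \<le> norm c * norm x * K"
    by (rule exI[of _ 1]) (simp add: norm_scaleC)
qed

lemma average_add: "average S (\<lambda>\<gamma>. f \<gamma> + g \<gamma>) = average S f + average S g"
  by (simp add: average_def sum.distrib scaleR_add_right)

lemma average_diff: "average S (\<lambda>\<gamma>. f \<gamma> - g \<gamma>) = average S f - average S g"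
  by (simp add: average_def sum_subtractf scaleR_diff_right)

lemma average_zero [simp]: "average S (\<lambda>\<gamma>. 0) = 0"
  by (simp add: average_def)

lemma average_const:
  assumes "finite S" "S \<noteq> {}"
  shows "average S (\<lambda>\<gamma>. c) = c"
  using assms by (simp add: average_def sum_constant_scaleR)

lemma average_linear:
  assumes "linear L"
  shows "average S (\<lambda>\<gamma>. L (f \<gamma>)) = L (average S f)"
  by (simp add: average_def linear_cmul[OF assms] linear_sum[OF assms])

lemma average_scaleC_left: "average S (\<lambda>\<gamma>. f \<gamma> *\<^sub>C x) = average S f *\<^sub>C x"
  for x :: "'a::complex_normed_vector"
  by (rule average_linear[of "\<lambda>c. c *\<^sub>C x"])
    (intro linearI bounded_bilinear.add_left bounded_bilinear.scaleR_left bounded_bilinear_scaleC)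

lemma average_scaleC_right: "average S (\<lambda>\<gamma>. c *\<^sub>C f \<gamma>) = c *\<^sub>C average S f"
  for f :: "_ \<Rightarrow> 'a::complex_normed_vector"
  by (rule average_linear[of "\<lambda>x. c *\<^sub>C x"])
    (intro linearI bounded_bilinear.add_right bounded_bilinear.scaleR_right bounded_bilinear_scaleC)

lemma average_cmult_right: "average S (\<lambda>\<gamma>. c * f \<gamma>) = c * average S f"
  for c :: "'a::real_algebra"
  by (simp add: average_def sum_distrib_left)

text \<open>The bound \<open>g\<close> may vary from point to point, as it must when it contains the
  values of a kernel of which only the mean is controlled.\<close>

lemma norm_average_le_average:
  assumes "\<And>\<gamma>. norm (f \<gamma>) \<le> g \<gamma>"
  shows "norm (average S f) \<le> average S g"
  unfolding average_def norm_scaleR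
  by (simp, intro mult_left_mono divide_right_mono sum_norm_le assms) simp_all

lemma average_apply_bcontfun:
  "apply_bcontfun (average S F) x = average S (\<lambda>\<gamma>. apply_bcontfun (F \<gamma>) x)"
  by (rule average_linear[symmetric]) (simp add: linear_iff)

section \<open>Characters and their averages along a Bohr-Bochner sequence\<close>

lemma norm_char_eval [simp]: "cmod (char_eval \<psi> x) = 1"
  and char_eval_add: "char_eval \<psi> (x + y) = char_eval \<psi> x * char_eval \<psi> y"
  using char_eval[of \<psi>] by auto

lemma char_eval_0 [simp]: "char_eval \<psi> 0 = 1"
  by (metis add_0 char_eval_add mult_cancel_right1 norm_char_eval norm_zero zero_neq_one)

lemma char_eval_uminus: "char_eval \<psi> (- x) = cnj (char_eval \<psi> x)"
proof -
  have "char_eval \<psi> (- x) * char_eval \<psi> x = 1"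
    by (simp flip: char_eval_add)
  moreover have "cnj (char_eval \<psi> x) * char_eval \<psi> x = 1"
    by (simp add: complex_norm_square[symmetric] mult.commute)
  ultimately show ?thesis
    by (metis mult_cancel_right mult_zero_right zero_neq_one)
qed

lemma char_eval_diff: "char_eval \<psi> (x - y) = char_eval \<psi> x * cnj (char_eval \<psi> y)"
  by (metis char_eval_add char_eval_uminus diff_conv_add_uminus)

text \<open>For a nontrivial character pick \<open>\<gamma>\<close> at which it is not 1.
  Multiplying the sum over \<open>H n\<close> by this value shifts \<open>H n\<close> by
  \<open>\<gamma>\<close>, which alters the sum only on the symmetric difference, and that is small
  compared with \<open>H n\<close>.\<close>

lemma average_char_tendsto:
  fixes \<psi> :: "'g::{ab_group_add} character"
  assumes H: "bohr_bochner H"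
  shows "(\<lambda>n. average (H n) (char_eval \<psi>)) \<longlonglongrightarrow> (if \<psi> = 0 then 1 else 0)"
proof (cases "\<psi> = 0")
  case True
  have "average (H n) (char_eval \<psi>) = 1" for n
    using H True by (simp add: zero_character.rep_eq average_const bohr_bochner_def)
  then show ?thesis using True by simp
next
  case False
  obtain \<gamma> where \<gamma>: "char_eval \<psi> \<gamma> \<noteq> 1"
    using False by (metis (no_types, lifting) char_eval_inject ext zero_character.rep_eq)
  let ?r = "\<lambda>n. real (card ((+) \<gamma> ` H n - H n)) / real (card (H n))"
  have bound: "cmod (average (H n) (char_eval \<psi>)) \<le> (2 / cmod (char_eval \<psi> \<gamma> - 1)) * ?r n" for n
  proof -
    let ?A = "H n" and ?B = "(+) \<gamma> ` H n"
    have fin: "finite ?A" "finite ?B" and ne: "?A \<noteq> {}"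
      using H by (auto simp: bohr_bochner_def)
    have card: "card ?B = card ?A"
      by (simp add: card_image)
    \<comment> \<open>The Bohr-Bochner condition controls only one half of the symmetric difference;
      the other half has the same size because \<open>?A\<close> and \<open>?B\<close> do. Hence the
      factor 2 in \<open>bound\<close>.\<close>
    have card': "card (?A - ?B) = card (?B - ?A)"
      using fin card by (metis card_Diff_subset_Int finite_Int inf_commute)
    have "(char_eval \<psi> \<gamma> - 1) * (\<Sum>x\<in>?A. char_eval \<psi> x) = (\<Sum>x\<in>?B. char_eval \<psi> x) - (\<Sum>x\<in>?A. char_eval \<psi> x)"
      by (simp add: sum.reindex left_diff_distrib sum_distrib_left sum_subtractf char_eval_add)
    also have "\<dots> = (\<Sum>x\<in>?B-?A. char_eval \<psi> x) - (\<Sum>x\<in>?A-?B. char_eval \<psi> x)"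
      using fin by (metis (no_types, lifting) Int_commute add_diff_cancel_left sum.Int_Diff)
    finally have "cmod (char_eval \<psi> \<gamma> - 1) * cmod (\<Sum>x\<in>?A. char_eval \<psi> x)
        \<le> cmod (\<Sum>x\<in>?B-?A. char_eval \<psi> x) + cmod (\<Sum>x\<in>?A-?B. char_eval \<psi> x)"
      by (metis norm_mult norm_triangle_ineq4)
    also have "\<dots> \<le> real (card (?B - ?A)) * 1 + real (card (?A - ?B)) * 1"
      by (intro add_mono order_trans[OF norm_sum] sum_bounded_above) simp_all
    finally have "cmod (\<Sum>x\<in>?A. char_eval \<psi> x) \<le> 2 * real (card (?B - ?A)) / cmod (char_eval \<psi> \<gamma> - 1)"
      using \<gamma> card' by (simp add: field_simps)
    then have "cmod (\<Sum>x\<in>?A. char_eval \<psi> x) / real (card ?A)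
       \<le> 2 * real (card (?B - ?A)) / cmod (char_eval \<psi> \<gamma> - 1) / real (card ?A)"
      by (rule divide_right_mono) simp
    then show ?thesis
      by (simp add: average_def norm_divide field_simps)
  qed
  have "?r \<longlonglongrightarrow> 0" using H by (auto simp: bohr_bochner_def)
  from tendsto_mult_right_zero[OF this, of "2 / cmod (char_eval \<psi> \<gamma> - 1)"]
  have "(\<lambda>n. average (H n) (char_eval \<psi>)) \<longlonglongrightarrow> 0"
    by (rule Lim_null_comparison[rotated]) (use bound in auto)
  then show ?thesis using False by simp
qed

section \<open>Equidistribution in the Bohr compactification\<close>

lemma continuous_on_char_eval:
  "continuous_on UNIV (\<lambda>x :: 'g::ab_group_add character. char_eval x \<gamma>)"
proof (rule continuous_on_compose2[of UNIV "\<lambda>f. f \<gamma>" UNIV char_eval])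
  show "continuous_on UNIV (char_eval :: 'g character \<Rightarrow> _)"
    unfolding continuous_on_open_vimage[OF open_UNIV] open_character_def by auto
qed (auto intro: continuous_on_product_coordinates)

text \<open>Distinct characters differ at some \<open>\<gamma>\<close>, and disjoint neighbourhoods
  of the two values pull back along evaluation at \<open>\<gamma>\<close>. The Stone-Weierstrass
  theorem is applied in this class.\<close>

instance character :: (ab_group_add) t2_space
proof
  fix x y :: "'a character"
  assume "x \<noteq> y"
  then obtain \<gamma> where "char_eval x \<gamma> \<noteq> char_eval y \<gamma>"
    by (metis char_eval_inject ext)
  then obtain U V where "open U" "open V" "char_eval x \<gamma> \<in> U" "char_eval y \<gamma> \<in> V" "U \<inter> V = {}"
    using hausdorff[OF \<open>char_eval x \<gamma> \<noteq> char_eval y \<gamma>\<close>] by (elim exE conjE)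
  then show "\<exists>U V. open U \<and> open V \<and> x \<in> U \<and> y \<in> V \<and> U \<inter> V = {}"
    by (intro exI[of _ "(\<lambda>x. char_eval x \<gamma>) -` U"] exI[of _ "(\<lambda>x. char_eval x \<gamma>) -` V"])
      (auto intro!: open_vimage continuous_on_char_eval)
qed

text \<open>By Tychonoff's theorem: multiplicativity cuts a closed set out of the compact product of
  circles, and the dual group carries the topology of that subset, so \<open>Abs_character\<close>
  transports compactness back.\<close>

lemma compact_UNIV_character: "compact (UNIV :: 'g::ab_group_add character set)"
proof -
  let ?C = "range (char_eval :: 'g character \<Rightarrow> _)"
  let ?P = "PiE UNIV (\<lambda>_::'g. sphere (0::complex) 1)"
  have "compactin (product_topology (\<lambda>_. euclidean) UNIV) ?P"
    by (simp add: compactin_PiE)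
  then have "compact ?P"
    by (simp add: euclidean_product_topology)
  moreover have C: "?C = ?P \<inter> {\<psi>. \<forall>x y. \<psi> (x + y) = \<psi> x * \<psi> y}"
  proof
    show "?C \<subseteq> ?P \<inter> {\<psi>. \<forall>x y. \<psi> (x + y) = \<psi> x * \<psi> y}"
    proof
      fix f :: "'g \<Rightarrow> complex"
      assume "f \<in> ?C"
      then obtain \<psi> where "f = char_eval \<psi>" by blast
      then show "f \<in> ?P \<inter> {\<psi>. \<forall>x y. \<psi> (x + y) = \<psi> x * \<psi> y}"
        using char_eval[of \<psi>] by (simp add: PiE_UNIV_domain)
    qed
    show "?P \<inter> {\<psi>. \<forall>x y. \<psi> (x + y) = \<psi> x * \<psi> y} \<subseteq> ?C"
    proof
      fix f :: "'g \<Rightarrow> complex"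
      assume "f \<in> ?P \<inter> {\<psi>. \<forall>x y. \<psi> (x + y) = \<psi> x * \<psi> y}"
      then have "f = char_eval (Abs_character f)"
        by (intro Abs_character_inverse[symmetric]) (simp add: PiE_UNIV_domain Pi_iff)
      then show "f \<in> ?C" by blast
    qed
  qed
  have "closed {\<psi> :: 'g \<Rightarrow> complex. \<forall>x y. \<psi> (x + y) = \<psi> x * \<psi> y}"
    by (intro closed_Collect_all closed_Collect_eq continuous_intros continuous_on_product_coordinates)
  ultimately have "compact ?C"
    unfolding C by (rule compact_Int_closed)
  moreover have "continuous_on ?C Abs_character"
    unfolding continuous_on_open_invariant
  proof (intro allI impI)
    fix B :: "'g character set"
    assume "open B"
    then obtain V where "open V" "B = char_eval -` V"
      by (auto simp: open_character_def)
    then show "\<exists>A. open A \<and> A \<inter> ?C = Abs_character -` B \<inter> ?C"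
      by (intro exI[of _ V]) (auto simp: char_eval_inverse)
  qed
  ultimately have "compact (Abs_character ` ?C)"
    by (rule compact_continuous_image[rotated])
  then show ?thesis
    by (simp add: image_image char_eval_inverse)
qed

text \<open>The real parts of trigonometric polynomials on the Bohr group, real-valued to fit
  Stone-Weierstrass. The complex factor \<open>c\<close> yields both cosines and sines and absorbs
  scaling.\<close>

inductive_set bohr_poly :: "('g::ab_group_add bohr \<Rightarrow> real) set" where
  char: "(\<lambda>x. Re (c * char_eval x \<psi>)) \<in> bohr_poly"
| add: "f \<in> bohr_poly \<Longrightarrow> g \<in> bohr_poly \<Longrightarrow> (\<lambda>x. f x + g x) \<in> bohr_poly"

lemma continuous_on_bohr_poly: "f \<in> bohr_poly \<Longrightarrow> continuous_on UNIV f"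
  by (induction rule: bohr_poly.induct) (intro continuous_intros continuous_on_char_eval)+

text \<open>The product-to-sum formula: \<open>Re u * Re v\<close> is half of
  \<open>Re (u * v) + Re (u * cnj v)\<close>, and for multiples of characters both products are
  again multiples of characters.\<close>

lemma bohr_poly_mult:
  assumes "f \<in> bohr_poly" "g \<in> bohr_poly"
  shows "(\<lambda>x. f x * g x) \<in> bohr_poly"
  using assms
proof (induction arbitrary: g rule: bohr_poly.induct)
  case (char c \<psi>)
  from char.prems show ?case
  proof (induction rule: bohr_poly.induct)
    case (char d \<phi>)
    have product: "Re u * Re v = Re (u * v) / 2 + Re (u * cnj v) / 2" for u v
      by (simp add: field_simps)
    have "Re (c * char_eval x \<psi>) * Re (d * char_eval x \<phi>) =
      Re (c * d / 2 * char_eval x (\<psi> + \<phi>)) + Re (c * cnj d / 2 * char_eval x (\<psi> - \<phi>))" for x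
    proof -
      have "c * d / 2 * char_eval x (\<psi> + \<phi>) = (c * char_eval x \<psi>) * (d * char_eval x \<phi>) / 2"
        "c * cnj d / 2 * char_eval x (\<psi> - \<phi>) = (c * char_eval x \<psi>) * cnj (d * char_eval x \<phi>) / 2"
        by (simp_all add: char_eval_add char_eval_diff)
      then show ?thesis
        by (simp only: product[of "c * char_eval x \<psi>"] Re_divide_numeral)
    qed
    then show ?case
      by (simp only:) (intro bohr_poly.intros)
  next
    case (add f g)
    then show ?case
      using bohr_poly.add[OF add.IH] by (simp only: distrib_left)
  qed
next
  case (add f f')
  then show ?case
    using bohr_poly.add[OF add.IH] by (simp only: distrib_right)
qed

text \<open>Stone-Weierstrass on a compact group: the algebra contains the constants, which come
  from the zero character, and it separates points.\<close>

lemma bohr_poly_dense: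
  fixes g :: "'g::ab_group_add bohr \<Rightarrow> real"
  assumes "continuous_on UNIV g" "e > 0"
  shows "\<exists>f\<in>bohr_poly. \<forall>x. \<bar>g x - f x\<bar> < e"
proof -
  interpret function_ring_on "bohr_poly :: ('g bohr \<Rightarrow> real) set" UNIV
  proof
    show "compact (UNIV :: 'g bohr set)"
      by (rule compact_UNIV_character)
    show "(\<lambda>_. c) \<in> bohr_poly" for c
      using bohr_poly.char[of "complex_of_real c" 0] by simp
    fix x y :: "'g bohr"
    assume "x \<noteq> y"
    then obtain \<psi> where "char_eval x \<psi> \<noteq> char_eval y \<psi>"
      by (metis char_eval_inject ext)
    \<comment> \<open>The choice 1 compares real parts, and \<open>- \<i>\<close> compares imaginary
      parts.\<close>
    then obtain c where "Re (c * char_eval x \<psi>) \<noteq> Re (c * char_eval y \<psi>)"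
      using that[of 1] that[of "- \<i>"] by (auto simp: complex_eq_iff)
    then show "\<exists>f\<in>bohr_poly. f x \<noteq> f y"
      by (intro bexI[OF _ bohr_poly.char])
  qed (auto intro: bohr_poly.add bohr_poly_mult continuous_on_bohr_poly)
  show ?thesis
    using Stone_Weierstrass_basic[OF assms] by simp
qed

lemma bohr_embed_eval: "char_eval (bohr_embed \<gamma>) \<psi> = char_eval \<psi> \<gamma>"
  by (simp add: bohr_embed.rep_eq)

section \<open>Haar integrals as limits of averages over the group\<close>

context
  fixes \<mu> :: "'g::ab_group_add bohr measure"
  assumes haar: "normalized_haar \<mu>"
begin

interpretation prob_space \<mu>
  using haar by (simp add: normalized_haar_def)

lemma borel_measurable_haar: "continuous_on UNIV f \<Longrightarrow> f \<in> borel_measurable \<mu>"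
  for f :: "'g bohr \<Rightarrow> 'b::topological_space"
  using borel_measurable_continuous_onI[of f] haar
  by (simp add: normalized_haar_def cong: measurable_cong_sets)

lemma integrable_haar_char: "integrable \<mu> (\<lambda>x. char_eval x \<psi>)"
  by (rule integrable_const_bound[of _ 1])
    (simp_all add: borel_measurable_haar continuous_on_char_eval)

text \<open>Translation by the image of \<open>\<gamma>\<close> multiplies the integral by
  \<open>char_eval \<psi> \<gamma>\<close>, yet invariance leaves it unchanged, so it vanishes when
  this factor is not 1. The values match the limits in \<open>average_char_tendsto\<close>.\<close>

lemma integral_haar_char: "(LINT x|\<mu>. char_eval x \<psi>) = (if \<psi> = 0 then 1 else 0)"
proof (cases "\<psi> = 0")
  case True
  then show ?thesis by (simp add: prob_space)
next
  case False
  obtain \<gamma> where \<gamma>: "char_eval \<psi> \<gamma> \<noteq> 1"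
    using False by (metis (no_types, lifting) char_eval_inject ext zero_character.rep_eq)
  let ?a = "bohr_embed \<gamma> :: 'g bohr"
  \<comment> \<open>Continuity makes the translation measurable for \<open>integral_distr\<close>.
    In each coordinate it is multiplication by a fixed number.\<close>
  have cont: "continuous_on UNIV (\<lambda>x. ?a + x)"
    unfolding continuous_on_open_vimage[OF open_UNIV]
  proof (intro allI impI)
    fix B :: "'g bohr set"
    assume "open B"
    then obtain V where V: "open V" "B = char_eval -` V"
      by (auto simp: open_character_def)
    have "continuous_on UNIV (\<lambda>f \<psi>. char_eval ?a \<psi> * f \<psi>)"
      by (intro continuous_on_coordinatewise_then_product continuous_intros
          continuous_on_product_coordinates)
    then have "open ((\<lambda>f \<psi>. char_eval ?a \<psi> * f \<psi>) -` V)"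
      using V by (simp add: open_vimage)
    then show "open ((\<lambda>x. ?a + x) -` B \<inter> UNIV)"
      unfolding open_character_def V
      by (intro exI[of _ "(\<lambda>f \<psi>. char_eval ?a \<psi> * f \<psi>) -` V"])
        (auto simp: plus_character.rep_eq)
  qed
  have "(LINT x|\<mu>. char_eval x \<psi>) = (LINT x|distr \<mu> borel (\<lambda>x. ?a + x). char_eval x \<psi>)"
    using haar by (simp add: normalized_haar_def)
  also have "\<dots> = (LINT x|\<mu>. char_eval (?a + x) \<psi>)"
    by (intro integral_distr borel_measurable_haar cont borel_measurable_continuous_onI
        continuous_on_char_eval)
  also have "\<dots> = char_eval \<psi> \<gamma> * (LINT x|\<mu>. char_eval x \<psi>)"
    by (simp add: plus_character.rep_eq bohr_embed_eval)
  finally show ?thesis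
    using \<gamma> False by simp
qed

text \<open>For one character the average and the integral obey the same orthogonality relation, and
  both are additive. Integrability is carried along because additivity of the integral requires
  it.\<close>

lemma bohr_poly_equidistributed:
  assumes H: "bohr_bochner H" and f: "f \<in> bohr_poly"
  shows "integrable \<mu> f \<and> (\<lambda>n. average (H n) (\<lambda>\<gamma>. f (bohr_embed \<gamma>))) \<longlonglongrightarrow> (LINT x|\<mu>. f x)"
  using f
proof (induction rule: bohr_poly.induct)
  case (char c \<psi>)
  have int: "integrable \<mu> (\<lambda>x. c * char_eval x \<psi>)"
    by (simp add: integrable_haar_char)
  have "average (H n) (\<lambda>\<gamma>. Re (c * char_eval \<psi> \<gamma>)) = Re (c * average (H n) (char_eval \<psi>))" for n
    by (rule average_linear[of "\<lambda>z. Re (c * z)"]) (intro linearI; simp add: algebra_simps)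
  moreover have "(LINT x|\<mu>. Re (c * char_eval x \<psi>)) = Re (c * (if \<psi> = 0 then 1 else 0))"
    using int by (simp add: integral_haar_char[symmetric] del: integral_mult_right_zero times_complex.simps)
      (metis integral_Re integral_mult_right_zero)
  moreover have "(\<lambda>n. Re (c * average (H n) (char_eval \<psi>))) \<longlonglongrightarrow> Re (c * (if \<psi> = 0 then 1 else 0))"
    by (intro tendsto_intros average_char_tendsto H)
  ultimately show ?case
    using int by (simp add: bohr_embed_eval del: times_complex.simps)
next
  case (add f g)
  then show ?case
    by (auto simp: average_add intro: tendsto_add)
qed

text \<open>Replacing \<open>g\<close> by a uniformly close \<open>bohr_poly\<close> changes the
  averages and the integral by at most \<open>e/3\<close> each, and for that function the limit is
  known.\<close>

theorem bohr_equidistributed: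
  assumes H: "bohr_bochner H" and g: "continuous_on UNIV (g :: 'g bohr \<Rightarrow> real)"
  shows "(\<lambda>n. average (H n) (\<lambda>\<gamma>. g (bohr_embed \<gamma>))) \<longlonglongrightarrow> (LINT x|\<mu>. g x)"
proof (rule LIMSEQ_I)
  fix e :: real
  assume "e > 0"
  then obtain f where f: "f \<in> bohr_poly" and fg: "\<And>x. \<bar>g x - f x\<bar> < e/3"
    using bohr_poly_dense[OF g, of "e/3"] by auto
  note int_f = bohr_poly_equidistributed[OF H f]
  \<comment> \<open>The difference is bounded, hence integrable; adding the integrable
    \<open>f\<close> then gives integrability of \<open>g\<close>.\<close>
  have "integrable \<mu> (\<lambda>x. g x - f x)"
  proof (rule integrable_const_bound[of _ "e/3"])
    show "AE x in \<mu>. norm (g x - f x) \<le> e/3"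
      using less_imp_le[OF fg] by (simp only: real_norm_def always_eventually simp_thms)
    show "(\<lambda>x. g x - f x) \<in> borel_measurable \<mu>"
      by (intro borel_measurable_haar continuous_on_diff g continuous_on_bohr_poly f)
  qed
  then have int: "integrable \<mu> g" "integrable \<mu> (\<lambda>x. \<bar>g x - f x\<bar>)"
    using Bochner_Integration.integrable_add[OF _ conjunct1[OF int_f], of "\<lambda>x. g x - f x"] by auto
  have "\<bar>(LINT x|\<mu>. g x) - (LINT x|\<mu>. f x)\<bar> = \<bar>LINT x|\<mu>. g x - f x\<bar>"
    using int int_f by simp
  also have "\<dots> \<le> (LINT x|\<mu>. \<bar>g x - f x\<bar>)"
    by (rule integral_abs_bound)
  also have "\<dots> \<le> (LINT x|\<mu>. e/3)"
    by (intro integral_mono int less_imp_le[OF fg]) simp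
  also have "\<dots> = e/3"
    by (simp add: prob_space)
  finally have 1: "\<bar>(LINT x|\<mu>. g x) - (LINT x|\<mu>. f x)\<bar> \<le> e/3" .
  have 2: "\<bar>average (H n) (\<lambda>\<gamma>. g (bohr_embed \<gamma>)) - average (H n) (\<lambda>\<gamma>. f (bohr_embed \<gamma>))\<bar> \<le> e/3" for n
  proof -
    have "norm (average (H n) (\<lambda>\<gamma>. g (bohr_embed \<gamma>) - f (bohr_embed \<gamma>))) \<le> e/3"
      using fg \<open>e > 0\<close> by (intro norm_average_le) (auto intro: less_imp_le)
    then show ?thesis
      by (simp add: average_diff)
  qed
  obtain N where N: "\<And>n. n \<ge> N \<Longrightarrow> \<bar>average (H n) (\<lambda>\<gamma>. f (bohr_embed \<gamma>)) - (LINT x|\<mu>. f x)\<bar> < e/3"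
    using LIMSEQ_D[OF conjunct2[OF int_f], of "e/3"] \<open>e > 0\<close> by auto
  have "norm (average (H n) (\<lambda>\<gamma>. g (bohr_embed \<gamma>)) - (LINT x|\<mu>. g x)) < e" if "n \<ge> N" for n
    using 1 2[of n] N[OF that] unfolding real_norm_def by linarith
  then show "\<exists>N. \<forall>n\<ge>N. norm (average (H n) (\<lambda>\<gamma>. g (bohr_embed \<gamma>)) - (LINT x|\<mu>. g x)) < e"
    by blast
qed

end

section \<open>Almost periodic functions\<close>

lemma char_tensor_eval: "apply_bcontfun (\<psi> \<otimes>\<^sub>c a) \<gamma> = char_eval \<psi> \<gamma> *\<^sub>C a"
  by (rule char_tensor.rep_eq[THEN fun_cong])

lemma norm_char_tensor_le: "norm (\<psi> \<otimes>\<^sub>c a) \<le> norm a"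
  by (rule norm_bound) (simp add: char_tensor_eval norm_scaleC)

lemma linear_char_tensor:
  "linear (\<lambda>a :: 'x::complex_normed_vector. \<psi> \<otimes>\<^sub>c a)"
proof (rule linearI)
  show "\<psi> \<otimes>\<^sub>c (a + b) = \<psi> \<otimes>\<^sub>c a + \<psi> \<otimes>\<^sub>c b" for a b :: 'x
    by (rule bcontfun_eqI) (simp add: char_tensor_eval scaleC_add_right)
  show "\<psi> \<otimes>\<^sub>c (r *\<^sub>R a) = r *\<^sub>R (\<psi> \<otimes>\<^sub>c a)" for r and a :: 'x
    by (rule bcontfun_eqI)
      (simp add: char_tensor_eval bounded_bilinear.scaleR_right[OF bounded_bilinear_scaleC])
qed

lemma bounded_linear_char_tensor: "bounded_linear (\<lambda>a. \<psi> \<otimes>\<^sub>c a)"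
  by (rule bounded_linear_intro[where K=1])
    (simp_all add: linear_add[OF linear_char_tensor] linear_cmul[OF linear_char_tensor] norm_char_tensor_le)

lemma translate_eval: "apply_bcontfun (translate \<gamma> f) x = apply_bcontfun f (x - \<gamma>)"
  by (simp add: translate.rep_eq)

lemma linear_translate: "linear (translate \<gamma>)"
  by (intro linearI bcontfun_eqI) (simp_all add: translate_eval)

lemma norm_translate_le: "norm (translate \<gamma> f) \<le> norm f"
  by (rule norm_bound) (simp add: translate_eval norm_bounded)

text \<open>Characters are joint eigenvectors of all translations, so averages of translates can be
  computed on trigonometric polynomials.\<close>

lemma translate_char_tensor: "translate \<gamma> (\<psi> \<otimes>\<^sub>c a) = cnj (char_eval \<psi> \<gamma>) *\<^sub>C (\<psi> \<otimes>\<^sub>c a)"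
  by (rule bcontfun_eqI)
    (simp add: translate_eval char_tensor_eval scaleC_bcontfun.rep_eq scaleC_scaleC char_eval_diff mult.commute)

text \<open>Peels off one summand at a time. The empty sum needs no case of its own, being a
  character with coefficient 0.\<close>

lemma trig_polys_induct [consumes 1, case_names char add]:
  assumes "f \<in> trig_polys"
    and char: "\<And>\<psi> a. P (\<psi> \<otimes>\<^sub>c a)"
    and add: "\<And>f g. P f \<Longrightarrow> P g \<Longrightarrow> P (f + g)"
  shows "P f"
proof -
  obtain n :: nat and \<psi> a where f: "f = (\<Sum>k<n. \<psi> k \<otimes>\<^sub>c a k)"
    using assms(1) by (auto simp: trig_polys_def)
  have "P (\<Sum>k<n. \<psi> k \<otimes>\<^sub>c a k)"
  proof (induction n)
    case 0
    show ?case using char[of 0 0] by (simp add: linear_0[OF linear_char_tensor])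
  next
    case (Suc n)
    then show ?case by (simp add: char add)
  qed
  then show ?thesis by (simp add: f)
qed

text \<open>A uniform bound on the operators lets convergence to 0 pass from a set to its closure,
  here from trigonometric polynomials to \<open>AP\<close>.\<close>

lemma tendsto_zero_closure:
  fixes A :: "nat \<Rightarrow> 'a::real_normed_vector \<Rightarrow> 'b::real_normed_vector"
  assumes lin: "\<And>n. linear (A n)"
    and K: "\<And>n x. norm (A n x) \<le> K * norm x"
    and S: "\<And>s. s \<in> S \<Longrightarrow> (\<lambda>n. A n s) \<longlonglongrightarrow> 0"
    and x: "x \<in> closure S"
  shows "(\<lambda>n. A n x) \<longlonglongrightarrow> 0"
proof (rule LIMSEQ_I)
  fix e :: real
  assume e: "e > 0"
  \<comment> \<open>\<open>K\<close> need not be positive, and the bound is divided by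
    below.\<close>
  define K' where "K' = max K 1"
  have K': "K' > 0" and le: "norm (A n x) \<le> K' * norm x" for n x
    by (auto simp: K'_def intro!: order_trans[OF K] mult_right_mono)
  obtain s where s: "s \<in> S" "dist s x < e / (2 * K')"
    using x e K' by (metis closure_approachable divide_pos_pos mult_pos_pos zero_less_numeral)
  obtain N where N: "\<forall>n\<ge>N. norm (A n s) < e/2"
    using LIMSEQ_D[OF S[OF s(1)], of "e/2"] e by auto
  have "norm (A n x) < e" if "n \<ge> N" for n
  proof -
    have "A n x = A n s + A n (x - s)"
      by (simp add: linear_diff[OF lin])
    moreover have "norm (A n (x - s)) \<le> K' * (e / (2 * K'))"
      using le[of n "x - s"] s(2) K' by (smt (verit) dist_commute dist_norm mult_left_mono)
    ultimately show ?thesis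
      using N that K' norm_triangle_ineq[of "A n s" "A n (x - s)"] by fastforce
  qed
  then show "\<exists>N. \<forall>n\<ge>N. norm (A n x - 0) < e"
    by auto
qed

text \<open>The same density argument when no limit is known in advance: the sequence is Cauchy, and
  completeness supplies the limit.\<close>

lemma convergent_closure:
  fixes A :: "nat \<Rightarrow> 'a::real_normed_vector \<Rightarrow> 'b::banach"
  assumes lin: "\<And>n. linear (A n)"
    and K: "\<And>n x. norm (A n x) \<le> K * norm x"
    and S: "\<And>s. s \<in> S \<Longrightarrow> convergent (\<lambda>n. A n s)"
    and x: "x \<in> closure S"
  shows "convergent (\<lambda>n. A n x)"
proof -
  have "Cauchy (\<lambda>n. A n x)"
  proof (rule CauchyI)
    fix e :: real
    assume e: "e > 0"
    define K' where "K' = max K 1"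
    have K': "K' > 0" and le: "norm (A n x) \<le> K' * norm x" for n x
    by (auto simp: K'_def intro!: order_trans[OF K] mult_right_mono)
    obtain s where s: "s \<in> S" "dist s x < e / (3 * K')"
      using x e K' by (metis closure_approachable divide_pos_pos mult_pos_pos zero_less_numeral)
    have close: "norm (A n x - A n s) \<le> e/3" for n
    proof -
      have "norm (A n (x - s)) \<le> K' * (e / (3 * K'))"
        using le[of n "x - s"] s(2) K' by (smt (verit) dist_commute dist_norm mult_left_mono)
      then show ?thesis using K' by (simp add: linear_diff[OF lin])
    qed
    obtain N where N: "\<forall>m\<ge>N. \<forall>n\<ge>N. norm (A m s - A n s) < e/3"
      using CauchyD[OF convergent_Cauchy[OF S[OF s(1)]], of "e/3"] e by auto
    have "norm (A m x - A n x) < e" if "m \<ge> N" "n \<ge> N" for m n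
    proof -
      have "norm (A m x - A n x) \<le> norm (A m x - A m s) + norm (A m s - A n s) + norm (A n x - A n s)"
        using norm_triangle_ineq[of "A m x - A m s" "A m s - A n s"]
          norm_triangle_ineq4[of "A m x - A n s" "A n x - A n s"] by simp
      moreover have "norm (A m s - A n s) < e/3" using N that by blast
      ultimately show ?thesis using close[of m] close[of n] by linarith
    qed
    then show "\<exists>N. \<forall>m\<ge>N. \<forall>n\<ge>N. norm (A m x - A n x) < e"
      by blast
  qed
  then show ?thesis by (simp add: Cauchy_convergent_iff)
qed

text \<open>These averages lie in every closed translation-invariant subspace containing \<open>f\<close>.\<close>

definition fourier_average ::
  "'g::{ab_group_add, discrete_topology} set \<Rightarrow> 'g character \<Rightarrow> ('g \<Rightarrow>\<^sub>C 'x::complex_normed_vector) \<Rightarrow> ('g \<Rightarrow>\<^sub>C 'x)"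
  where "fourier_average S \<psi> f = average S (\<lambda>\<gamma>. cnj (char_eval \<psi> \<gamma>) *\<^sub>C translate (- \<gamma>) f)"

lemma fourier_average_eval:
  "apply_bcontfun (fourier_average S \<psi> f) x =
    average S (\<lambda>\<gamma>. cnj (char_eval \<psi> \<gamma>) *\<^sub>C apply_bcontfun f (x + \<gamma>))"
  by (simp add: fourier_average_def average_apply_bcontfun scaleC_bcontfun.rep_eq translate_eval)

lemma linear_fourier_average: "linear (fourier_average S \<psi>)"
proof (rule linearI)
  note bil = bounded_bilinear_scaleC
  show "fourier_average S \<psi> (f + g) = fourier_average S \<psi> f + fourier_average S \<psi> g" for f g :: "'a \<Rightarrow>\<^sub>C 'b"
    by (rule bcontfun_eqI)
      (simp add: fourier_average_eval scaleC_add_right average_add)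
  show "fourier_average S \<psi> (r *\<^sub>R f) = r *\<^sub>R fourier_average S \<psi> f" for r and f :: "'a \<Rightarrow>\<^sub>C 'b"
    by (rule bcontfun_eqI)
      (simp add: fourier_average_eval bounded_bilinear.scaleR_right[OF bil] average_linear[OF linear_scaleR])
qed

lemma norm_fourier_average_le: "norm (fourier_average S \<psi> f) \<le> norm f"
  unfolding fourier_average_def
  by (rule norm_average_le) (simp_all add: norm_scaleC norm_translate_le)

lemma average_char_cnj_char_tendsto:
  assumes "bohr_bochner H"
  shows "(\<lambda>n. average (H n) (\<lambda>\<gamma>. cnj (char_eval \<psi> \<gamma>) * char_eval \<phi> \<gamma>)) \<longlonglongrightarrow> (if \<phi> = \<psi> then 1 else 0)"
proof -
  have "cnj (char_eval \<psi> \<gamma>) * char_eval \<phi> \<gamma> = char_eval (\<phi> - \<psi>) \<gamma>" for \<gamma>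
    by (simp only: minus_character_def plus_character.rep_eq uminus_character.rep_eq mult.commute)
  then show ?thesis
    using average_char_tendsto[OF assms, of "\<phi> - \<psi>"] by simp
qed

text \<open>On an eigenvector of the translations the averaging operator is a scalar, so convergence
  in supremum norm reduces to orthogonality of characters.\<close>

lemma fourier_average_char_tendsto:
  assumes "bohr_bochner H"
  shows "(\<lambda>n. fourier_average (H n) \<psi> (\<phi> \<otimes>\<^sub>c a)) \<longlonglongrightarrow> (if \<phi> = \<psi> then \<phi> \<otimes>\<^sub>c a else 0)"
proof -
  have "fourier_average (H n) \<psi> (\<phi> \<otimes>\<^sub>c a) =
      average (H n) (\<lambda>\<gamma>. cnj (char_eval \<psi> \<gamma>) * char_eval \<phi> \<gamma>) *\<^sub>C (\<phi> \<otimes>\<^sub>c a)" for n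
    by (simp add: fourier_average_def translate_char_tensor char_eval_uminus scaleC_scaleC average_scaleC_left)
  moreover have "(if \<phi> = \<psi> then \<phi> \<otimes>\<^sub>c a else 0) = (if \<phi> = \<psi> then 1 else 0) *\<^sub>C (\<phi> \<otimes>\<^sub>c a)"
    by (simp add: bounded_bilinear.zero_left[OF bounded_bilinear_scaleC])
  ultimately show ?thesis
    by (simp only: bounded_bilinear.tendsto[OF bounded_bilinear_scaleC
          average_char_cnj_char_tendsto[OF assms] tendsto_const])
qed

section \<open>Fourier coefficients and Bohr continuity of almost periodic functions\<close>

lemma tendsto_apply_bcontfun:
  fixes f :: "'a::topological_space \<Rightarrow>\<^sub>C 'b::real_normed_vector"
  assumes "(F \<longlongrightarrow> f) net"
  shows "((\<lambda>n. apply_bcontfun (F n) x) \<longlongrightarrow> apply_bcontfun f x) net"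
proof -
  have "bounded_linear (\<lambda>f :: 'a \<Rightarrow>\<^sub>C 'b. apply_bcontfun f x)"
    by (rule bounded_linear_intro[where K=1]) (simp_all add: norm_bounded)
  then show ?thesis
    using assms by (rule bounded_linear.tendsto)
qed

text \<open>The value of a \<open>lim\<close> is meaningful only once convergence is known. The
  averages in question are the values of \<open>fourier_average\<close> at 0, a contraction in
  \<open>h\<close> that converges on characters.\<close>

lemma fourier_coeff_tendsto:
  fixes h :: "'g::{ab_group_add, discrete_topology} \<Rightarrow>\<^sub>C 'x::{complex_normed_vector, banach}"
  assumes H: "bohr_bochner H" and h: "h \<in> AP"
  shows "(\<lambda>n. average (H n) (\<lambda>\<gamma>. cnj (char_eval \<psi> \<gamma>) *\<^sub>C apply_bcontfun h \<gamma>)) \<longlonglongrightarrow> fourier_coeff H h \<psi>"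
proof -
  let ?F = "\<lambda>n f. apply_bcontfun (fourier_average (H n) \<psi> f) (0::'g) :: 'x"
  have "convergent (\<lambda>n. ?F n h)"
  proof (rule convergent_closure[where K=1 and S=trig_polys])
    show "linear (?F n)" for n
      by (intro linearI) (simp_all add: linear_add[OF linear_fourier_average] linear_cmul[OF linear_fourier_average])
    show "norm (?F n f) \<le> 1 * norm f" for n f
      using norm_bounded[of "fourier_average (H n) \<psi> f" 0] norm_fourier_average_le[of "H n" \<psi> f] by simp
    show "convergent (\<lambda>n. ?F n t)" if "t \<in> trig_polys" for t
      using that
    proof (induction rule: trig_polys_induct)
      case (char \<phi> a)
      show ?case
        using tendsto_apply_bcontfun[OF fourier_average_char_tendsto[OF H]] by (rule convergentI)
    next
      case (add f g)
      then show ?case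
        by (simp add: linear_add[OF linear_fourier_average] convergent_add)
    qed
    show "h \<in> closure trig_polys" using h by (simp add: AP_def)
  qed
  then show ?thesis
    by (simp add: fourier_average_eval fourier_coeff_def convergent_LIMSEQ_iff)
qed

text \<open>The comparison function \<open>?F n h\<close> is \<open>\<psi>\<close> with the value of
  the average at 0 as coefficient. The difference tends to 0 on characters, hence on
  \<open>AP\<close>, while \<open>?F n h\<close> converges with its coefficient.\<close>

theorem fourier_average_tendsto:
  fixes h :: "'g::{ab_group_add, discrete_topology} \<Rightarrow>\<^sub>C 'x::{complex_normed_vector, banach}"
  assumes H: "bohr_bochner H" and h: "h \<in> AP"
  shows "(\<lambda>n. fourier_average (H n) \<psi> h) \<longlonglongrightarrow> \<psi> \<otimes>\<^sub>c fourier_coeff H h \<psi>"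
proof -
  let ?F = "\<lambda>n f. \<psi> \<otimes>\<^sub>c apply_bcontfun (fourier_average (H n) \<psi> f) 0 :: 'g \<Rightarrow>\<^sub>C 'x"
  have lin: "linear (?F n)" for n
    by (intro linearI) (simp_all add: linear_add[OF linear_fourier_average] linear_cmul[OF linear_fourier_average]
        linear_add[OF linear_char_tensor] linear_cmul[OF linear_char_tensor])
  have "(\<lambda>n. fourier_average (H n) \<psi> h - ?F n h) \<longlonglongrightarrow> 0"
  proof (rule tendsto_zero_closure[where K=2 and S=trig_polys])
    show "linear (\<lambda>f. fourier_average (H n) \<psi> f - ?F n f)" for n
      by (intro linear_compose_sub linear_fourier_average lin)
    show "norm (fourier_average (H n) \<psi> f - ?F n f) \<le> 2 * norm f" for n f
    proof -
      have "norm (?F n f) \<le> norm f"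
        by (intro order_trans[OF norm_char_tensor_le] order_trans[OF norm_bounded] norm_fourier_average_le)
      then show ?thesis
        using norm_triangle_ineq4[of "fourier_average (H n) \<psi> f" "?F n f"] norm_fourier_average_le[of "H n" \<psi> f]
        by linarith
    qed
    show "(\<lambda>n. fourier_average (H n) \<psi> t - ?F n t) \<longlonglongrightarrow> 0" if "t \<in> trig_polys" for t
      using that
    proof (induction rule: trig_polys_induct)
      case (char \<phi> a)
      let ?L = "if \<phi> = \<psi> then \<phi> \<otimes>\<^sub>c a else 0"
      have "(\<lambda>n. fourier_average (H n) \<psi> (\<phi> \<otimes>\<^sub>c a) - ?F n (\<phi> \<otimes>\<^sub>c a)) \<longlonglongrightarrow> ?L - \<psi> \<otimes>\<^sub>c apply_bcontfun ?L 0"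
        by (intro tendsto_diff fourier_average_char_tendsto[OF H] bounded_linear.tendsto[OF bounded_linear_char_tensor]
            tendsto_apply_bcontfun)
      \<comment> \<open>If \<open>\<phi>\<close> differs from \<open>\<psi>\<close> both terms are
        0; otherwise the value of \<open>\<phi> \<otimes>\<^sub>c a\<close> at 0 is
        \<open>a\<close>.\<close>
      moreover have "?L - \<psi> \<otimes>\<^sub>c apply_bcontfun ?L 0 = 0"
        by (simp add: char_tensor_eval linear_0[OF linear_char_tensor])
      ultimately show ?case by simp
    next
      case (add f g)
      from tendsto_add[OF add] show ?case
        by (simp add: linear_add[OF linear_fourier_average] linear_add[OF linear_char_tensor] algebra_simps)
    qed
    show "h \<in> closure trig_polys" using h by (simp add: AP_def)
  qed
  moreover have "(\<lambda>n. ?F n h) \<longlonglongrightarrow> \<psi> \<otimes>\<^sub>c fourier_coeff H h \<psi>"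
    using fourier_coeff_tendsto[OF H h, of \<psi>]
    by (intro bounded_linear.tendsto[OF bounded_linear_char_tensor]) (simp add: fourier_average_eval)
  ultimately show ?thesis
    using tendsto_add by fastforce
qed

text \<open>Uniform continuity for the Bohr topology. For one character it says that
  \<open>char_eval x \<psi>\<close> is near 1, an open condition on \<open>x\<close>; sums intersect
  neighbourhoods; the closure is reached because translations do not increase the norm.\<close>

lemma AP_translate_near:
  assumes h: "h \<in> AP" and "e > 0"
  shows "\<exists>V. open V \<and> 0 \<in> V \<and> (\<forall>\<gamma>. bohr_embed \<gamma> \<in> V \<longrightarrow> norm (translate \<gamma> h - h) < e)"
proof -
  have trig: "\<exists>V. open V \<and> 0 \<in> V \<and> (\<forall>\<gamma>. bohr_embed \<gamma> \<in> V \<longrightarrow> norm (translate \<gamma> t - t) < e)"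
    if "t \<in> trig_polys" "e > 0" for t :: "'a \<Rightarrow>\<^sub>C 'b" and e :: real
    using that
  proof (induction arbitrary: e rule: trig_polys_induct)
    case (char \<psi> a)
    let ?V = "{x. cmod (cnj (char_eval x \<psi>) - 1) * norm (\<psi> \<otimes>\<^sub>c a) < e}"
    have "open ?V"
      by (intro open_Collect_less continuous_intros continuous_on_char_eval)
    moreover have "norm (translate \<gamma> (\<psi> \<otimes>\<^sub>c a) - \<psi> \<otimes>\<^sub>c a) = cmod (cnj (char_eval \<psi> \<gamma>) - 1) * norm (\<psi> \<otimes>\<^sub>c a)" for \<gamma>
      by (simp add: translate_char_tensor bounded_bilinear.diff_left[OF bounded_bilinear_scaleC] flip: norm_scaleC)
    ultimately show ?case
      using char by (intro exI[of _ ?V]) (auto simp: bohr_embed_eval zero_character.rep_eq)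
  next
    case (add f g)
    obtain V W where V: "open V" "0 \<in> V" "\<forall>\<gamma>. bohr_embed \<gamma> \<in> V \<longrightarrow> norm (translate \<gamma> f - f) < e/2"
      and W: "open W" "0 \<in> W" "\<forall>\<gamma>. bohr_embed \<gamma> \<in> W \<longrightarrow> norm (translate \<gamma> g - g) < e/2"
      using add.IH[of "e/2"] add.prems by (meson half_gt_zero)
    have "norm (translate \<gamma> (f + g) - (f + g)) \<le> norm (translate \<gamma> f - f) + norm (translate \<gamma> g - g)" for \<gamma>
      by (metis (no_types) add_diff_add linear_add linear_translate norm_triangle_ineq)
    moreover have "norm (translate \<gamma> f - f) + norm (translate \<gamma> g - g) < e" if "bohr_embed \<gamma> \<in> V \<inter> W" for \<gamma>
    proof -
      have "norm (translate \<gamma> f - f) < e/2" "norm (translate \<gamma> g - g) < e/2"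
        using V(3) W(3) that by blast+
      then show ?thesis by linarith
    qed
    ultimately show ?case
      using V(1,2) W(1,2) by (intro exI[of _ "V \<inter> W"]) (auto simp: open_Int intro: le_less_trans)
  qed
  obtain t where t: "t \<in> trig_polys" "norm (t - h) < e/3"
    using h \<open>e > 0\<close> unfolding AP_def closure_approachable dist_norm by (metis divide_pos_pos zero_less_numeral)
  obtain V where V: "open V" "0 \<in> V" "\<And>\<gamma>. bohr_embed \<gamma> \<in> V \<Longrightarrow> norm (translate \<gamma> t - t) < e/3"
    using trig[OF t(1), of "e/3"] \<open>e > 0\<close> by auto
  have "norm (translate \<gamma> h - h) < e" if "bohr_embed \<gamma> \<in> V" for \<gamma>
  proof -
    have "norm (translate \<gamma> h - h) = norm ((translate \<gamma> t - t) - translate \<gamma> (t - h) + (t - h))"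
      by (simp add: linear_diff[OF linear_translate])
    then show ?thesis
      using norm_triangle_ineq[of "translate \<gamma> t - t - translate \<gamma> (t - h)" "t - h"]
        norm_triangle_ineq4[of "translate \<gamma> t - t" "translate \<gamma> (t - h)"] t(2) V(3)[OF that] norm_translate_le[of \<gamma> "t - h"] by linarith
  qed
  then show ?thesis using V by blast
qed

section \<open>Mean convolution with a trigonometric polynomial\<close>

text \<open>At a point \<open>x\<close> this averages the terms of the mean convolution over the
  translate of \<open>S\<close> by \<open>x\<close>. As an average of translates of \<open>f\<close>
  it can be compared with \<open>f\<close> in supremum norm.\<close>

definition conv_average ::
  "'g::{ab_group_add, discrete_topology} set \<Rightarrow> ('g \<Rightarrow>\<^sub>C complex) \<Rightarrow> ('g \<Rightarrow>\<^sub>C 'x::complex_normed_vector) \<Rightarrow> ('g \<Rightarrow>\<^sub>C 'x)"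
  where "conv_average S p f = average S (\<lambda>\<gamma>. apply_bcontfun p (- \<gamma>) *\<^sub>C translate (- \<gamma>) f)"

lemma conv_average_add_left: "conv_average S (p + q) f = conv_average S p f + conv_average S q f"
  by (simp add: conv_average_def scaleC_add_left average_add)

lemma conv_average_char: "conv_average S (\<psi> \<otimes>\<^sub>c c) f = c *\<^sub>C fourier_average S \<psi> f"
  by (simp add: conv_average_def fourier_average_def char_tensor_eval char_eval_uminus
      scaleC_complex_def scaleC_scaleC mult.commute flip: average_scaleC_right)

context
  fixes H :: "nat \<Rightarrow> 'g::{ab_group_add, discrete_topology} set"
    and h :: "'g \<Rightarrow>\<^sub>C 'x::{complex_normed_vector, banach}"
  assumes H: "bohr_bochner H" and h: "h \<in> AP"
begin

text \<open>The averages of translates of \<^term>\<open>h\<close> and the averages defining the mean convolution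
  differ by a reflection of the sets of summation, but both limits are the same combination of the
  Fourier coefficients. The set \<open>W\<close> carries this information without naming the coefficients
  of \<open>p\<close>.\<close>

lemma conv_average_limit:
  assumes p: "p \<in> trig_polys"
    and W_add: "\<And>f g. f \<in> W \<Longrightarrow> g \<in> W \<Longrightarrow> f + g \<in> W"
    and W_scaleC: "\<And>c f. f \<in> W \<Longrightarrow> c *\<^sub>C f \<in> W"
    and W_char: "\<And>\<psi>. \<psi> \<otimes>\<^sub>c fourier_coeff H h \<psi> \<in> W"
  shows "\<exists>f\<in>W. (\<lambda>n. conv_average (H n) p h) \<longlonglongrightarrow> f \<and>
    (\<forall>x. (\<lambda>n. average (H n) (\<lambda>\<gamma>. apply_bcontfun p (x - \<gamma>) *\<^sub>C apply_bcontfun h \<gamma>)) \<longlonglongrightarrow> apply_bcontfun f x)"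
  using p
proof (induction rule: trig_polys_induct)
  case (char \<psi> c)
  let ?f = "c *\<^sub>C (\<psi> \<otimes>\<^sub>c fourier_coeff H h \<psi>)"
  have "(\<lambda>n. conv_average (H n) (\<psi> \<otimes>\<^sub>c c) h) \<longlonglongrightarrow> ?f"
    unfolding conv_average_char
    by (intro bounded_bilinear.tendsto[OF bounded_bilinear_scaleC] tendsto_const fourier_average_tendsto H h)
  moreover have "(\<lambda>n. average (H n) (\<lambda>\<gamma>. apply_bcontfun (\<psi> \<otimes>\<^sub>c c) (x - \<gamma>) *\<^sub>C apply_bcontfun h \<gamma>)) \<longlonglongrightarrow> apply_bcontfun ?f x" for x
  proof -
    have "average (H n) (\<lambda>\<gamma>. apply_bcontfun (\<psi> \<otimes>\<^sub>c c) (x - \<gamma>) *\<^sub>C apply_bcontfun h \<gamma>) =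
      (c * char_eval \<psi> x) *\<^sub>C average (H n) (\<lambda>\<gamma>. cnj (char_eval \<psi> \<gamma>) *\<^sub>C apply_bcontfun h \<gamma>)" for n
      by (simp add: char_tensor_eval char_eval_diff scaleC_complex_def scaleC_scaleC mult_ac
          flip: average_scaleC_right)
    moreover have "apply_bcontfun ?f x = (c * char_eval \<psi> x) *\<^sub>C fourier_coeff H h \<psi>"
      by (simp add: scaleC_bcontfun.rep_eq char_tensor_eval scaleC_scaleC)
    ultimately show ?thesis
      by (simp only: bounded_bilinear.tendsto[OF bounded_bilinear_scaleC tendsto_const fourier_coeff_tendsto[OF H h]])
  qed
  ultimately show ?case
    using W_scaleC[OF W_char] by blast
next
  case (add p q)
  then obtain f g where "f \<in> W" "(\<lambda>n. conv_average (H n) p h) \<longlonglongrightarrow> f"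
    "\<And>x. (\<lambda>n. average (H n) (\<lambda>\<gamma>. apply_bcontfun p (x - \<gamma>) *\<^sub>C apply_bcontfun h \<gamma>)) \<longlonglongrightarrow> apply_bcontfun f x"
    "g \<in> W" "(\<lambda>n. conv_average (H n) q h) \<longlonglongrightarrow> g"
    "\<And>x. (\<lambda>n. average (H n) (\<lambda>\<gamma>. apply_bcontfun q (x - \<gamma>) *\<^sub>C apply_bcontfun h \<gamma>)) \<longlonglongrightarrow> apply_bcontfun g x"
    by blast
  then show ?case
    by (intro bexI[of _ "f + g"] conjI allI W_add)
      (simp_all add: conv_average_add_left scaleC_add_left average_add tendsto_add)
qed

lemma mean_conv_eqI:
  assumes "\<And>x. (\<lambda>n. average (H n) (\<lambda>\<gamma>. apply_bcontfun p (x - \<gamma>) *\<^sub>C apply_bcontfun h \<gamma>)) \<longlonglongrightarrow> apply_bcontfun f x"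
  shows "mean_conv H p h = f"
  by (rule bcontfun_eqI) (simp add: mean_conv.rep_eq limI[OF assms])

text \<open>The mean convolution is a finite combination of Fourier components of \<open>h\<close>,
  so any subspace holding these contains it. The kernel of an operator will be such a
  \<open>W\<close>.\<close>

lemma mean_conv_mem:
  assumes "p \<in> trig_polys"
    and "\<And>f g. f \<in> W \<Longrightarrow> g \<in> W \<Longrightarrow> f + g \<in> W"
    and "\<And>c f. f \<in> W \<Longrightarrow> c *\<^sub>C f \<in> W"
    and "\<And>\<psi>. \<psi> \<otimes>\<^sub>c fourier_coeff H h \<psi> \<in> W"
  shows "mean_conv H p h \<in> W"
  using conv_average_limit[OF assms] mean_conv_eqI by metis

lemma conv_average_tendsto:
  assumes "p \<in> trig_polys"
  shows "(\<lambda>n. conv_average (H n) p h) \<longlonglongrightarrow> mean_conv H p h"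
  using conv_average_limit[OF assms, of UNIV] mean_conv_eqI by auto

end

text \<open>Reflection turns \<open>\<psi>\<close> into \<open>- \<psi>\<close>, which is trivial
  exactly when \<open>\<psi>\<close> is, so both limits agree. The reflected average is the total
  weight in \<open>conv_average\<close>.\<close>

lemma trig_polys_mean:
  assumes H: "bohr_bochner H" and p: "p \<in> trig_polys"
  shows "(\<lambda>n. average (H n) (apply_bcontfun p)) \<longlonglongrightarrow> mean H p"
    and "(\<lambda>n. average (H n) (\<lambda>\<gamma>. apply_bcontfun p (- \<gamma>))) \<longlonglongrightarrow> mean H p"
proof -
  have "\<exists>m. (\<lambda>n. average (H n) (apply_bcontfun p)) \<longlonglongrightarrow> m \<and>
      (\<lambda>n. average (H n) (\<lambda>\<gamma>. apply_bcontfun p (- \<gamma>))) \<longlonglongrightarrow> m"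
    using p
  proof (induction rule: trig_polys_induct)
    case (char \<psi> c)
    have "average (H n) (\<lambda>\<gamma>. apply_bcontfun (\<psi> \<otimes>\<^sub>c c) \<gamma>) = average (H n) (char_eval \<psi>) *\<^sub>C c"
      and "average (H n) (\<lambda>\<gamma>. apply_bcontfun (\<psi> \<otimes>\<^sub>c c) (- \<gamma>)) = average (H n) (char_eval (- \<psi>)) *\<^sub>C c" for n
      by (simp_all add: char_tensor_eval char_eval_uminus uminus_character.rep_eq flip: average_scaleC_left)
    moreover have "(\<lambda>n. average (H n) (char_eval \<psi>) *\<^sub>C c) \<longlonglongrightarrow> (if \<psi> = 0 then 1 else 0) *\<^sub>C c"
      and "(\<lambda>n. average (H n) (char_eval (- \<psi>)) *\<^sub>C c) \<longlonglongrightarrow> (if - \<psi> = 0 then 1 else 0) *\<^sub>C c"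
      by (intro bounded_bilinear.tendsto[OF bounded_bilinear_scaleC] average_char_tendsto H tendsto_const)+
    ultimately show ?case
      by (intro exI[of _ "(if \<psi> = 0 then 1 else 0) *\<^sub>C c"]) simp
  next
    case (add f g)
    then obtain a b where "(\<lambda>n. average (H n) (apply_bcontfun f)) \<longlonglongrightarrow> a"
      "(\<lambda>n. average (H n) (\<lambda>\<gamma>. apply_bcontfun f (- \<gamma>))) \<longlonglongrightarrow> a"
      "(\<lambda>n. average (H n) (apply_bcontfun g)) \<longlonglongrightarrow> b"
      "(\<lambda>n. average (H n) (\<lambda>\<gamma>. apply_bcontfun g (- \<gamma>))) \<longlonglongrightarrow> b"
      by blast
    then show ?case
      by (intro exI[of _ "a + b"]) (simp add: plus_bcontfun.rep_eq average_add tendsto_add)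
  qed
  then show "(\<lambda>n. average (H n) (apply_bcontfun p)) \<longlonglongrightarrow> mean H p"
    "(\<lambda>n. average (H n) (\<lambda>\<gamma>. apply_bcontfun p (- \<gamma>))) \<longlonglongrightarrow> mean H p"
    by (auto simp: mean_def limI)
qed

section \<open>Bochner-Fejer approximation\<close>

lemma bochner_fejer_trig_polys:
  assumes "bochner_fejer H \<mu> \<U> p" "U \<in> \<U>" "\<epsilon> \<in> {0<..<1}"
  shows "p U \<epsilon> \<in> trig_polys"
  using assms unfolding bochner_fejer_def by blast

text \<open>The mean of \<open>q U \<epsilon>\<close> is within \<open>\<epsilon>\<close> of the integral 1 of \<open>g U\<close> by equidistribution, so the rescaling factor
  is at most \<open>2\<close> for \<open>\<epsilon> \<le> 1/2\<close>.\<close>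

lemma bochner_fejer_small_outside:
  fixes H :: "nat \<Rightarrow> 'g::{ab_group_add, discrete_topology} set"
  assumes H: "bohr_bochner H" and \<mu>: "normalized_haar \<mu>" and bf: "bochner_fejer H \<mu> \<U> p"
    and U: "U \<in> \<U>" and \<epsilon>: "0 < \<epsilon>" "\<epsilon> \<le> 1/2"
    and x: "bohr_embed x \<notin> U"
  shows "cmod (apply_bcontfun (p U \<epsilon>) x) \<le> 4 * \<epsilon>"
proof -
  have \<epsilon>1: "\<epsilon> \<in> {0<..<1}" using \<epsilon> by simp
  obtain G and Q :: "'g bohr set \<Rightarrow> real \<Rightarrow> 'g \<Rightarrow>\<^sub>C complex" where
    G: "\<forall>U\<in>\<U>. continuous_on UNIV (G U) \<and> (\<forall>x. G U x \<ge> 0) \<and>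
      closure {x. G U x \<noteq> 0} \<subseteq> U \<and> (LINT x|\<mu>. G U x) = 1"
    and Q: "\<forall>U\<in>\<U>. \<forall>\<epsilon>\<in>{0<..<1}. Q U \<epsilon> \<in> trig_polys \<and>
      (\<forall>\<gamma>. apply_bcontfun (Q U \<epsilon>) \<gamma> \<in> \<real> \<and>
        cmod (apply_bcontfun (Q U \<epsilon>) \<gamma> - complex_of_real (G U (bohr_embed \<gamma>))) \<le> \<epsilon>) \<and>
      p U \<epsilon> \<in> trig_polys \<and> (\<forall>\<gamma>. apply_bcontfun (p U \<epsilon>) \<gamma> \<in> \<real>\<^sub>\<ge>\<^sub>0) \<and> mean H (p U \<epsilon>) = 1 \<and>
      (\<exists>c::real. \<exists>s\<in>{0, \<epsilon>}. \<forall>\<gamma>. apply_bcontfun (p U \<epsilon>) \<gamma> =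
        complex_of_real c * (apply_bcontfun (Q U \<epsilon>) \<gamma> + complex_of_real s))"
    using bf unfolding bochner_fejer_def by (elim exE conjE)
  define g q where "g = G U" and "q = Q U \<epsilon>"
  have g: "continuous_on UNIV g" "closure {x. g x \<noteq> 0} \<subseteq> U" "(LINT x|\<mu>. g x) = 1"
    using G[THEN bspec, OF U] by (simp_all only: g_def)
  note Q' = Q[THEN bspec, OF U, THEN bspec, OF \<epsilon>1, folded g_def q_def]
  have q: "q \<in> trig_polys"
      "\<And>\<gamma>. cmod (apply_bcontfun q \<gamma> - complex_of_real (g (bohr_embed \<gamma>))) \<le> \<epsilon>"
    and p: "p U \<epsilon> \<in> trig_polys" "mean H (p U \<epsilon>) = 1"
    using Q' by simp_all
  obtain c s where s: "s \<in> {0, \<epsilon>}" and pq: "\<And>\<gamma>. apply_bcontfun (p U \<epsilon>) \<gamma> =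
      complex_of_real c * (apply_bcontfun q \<gamma> + complex_of_real s)"
    using Q' by (elim conjE exE bexE) (erule that, erule spec)
  have fin: "finite (H n)" "H n \<noteq> {}" for n
    using H by (auto simp: bohr_bochner_def)
  \<comment> \<open>The averages of \<open>g\<close> tend to its Haar integral 1 by
    equidistribution. As the integrand is pointwise at most \<open>\<epsilon>\<close> in modulus,
    this puts \<open>mean H q\<close> within \<open>\<epsilon>\<close> of 1.\<close>
  have "(\<lambda>n. average (H n) (\<lambda>\<gamma>. apply_bcontfun q \<gamma> - complex_of_real (g (bohr_embed \<gamma>)))) \<longlonglongrightarrow>
      mean H q - complex_of_real 1"
    unfolding average_diff average_linear[OF bounded_linear.linear[OF bounded_linear_of_real]] g(3)[symmetric]
    by (intro tendsto_intros trig_polys_mean H q bohr_equidistributed[OF \<mu>] g)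
  then have "(\<lambda>n. norm (average (H n) (\<lambda>\<gamma>. apply_bcontfun q \<gamma> - complex_of_real (g (bohr_embed \<gamma>))))) \<longlonglongrightarrow>
      cmod (mean H q - complex_of_real 1)"
    by (rule tendsto_norm)
  moreover have "norm (average (H n) (\<lambda>\<gamma>. apply_bcontfun q \<gamma> - complex_of_real (g (bohr_embed \<gamma>)))) \<le> \<epsilon>" for n
    using q \<epsilon> by (intro norm_average_le) auto
  ultimately have mq: "cmod (mean H q - 1) \<le> \<epsilon>"
    using LIMSEQ_le_const2 by (metis (no_types, lifting) of_real_1)
  have "average (H n) (apply_bcontfun (p U \<epsilon>)) = complex_of_real c * (average (H n) (apply_bcontfun q) + complex_of_real s)" for n
    using fin by (simp add: ext[of "apply_bcontfun (p U \<epsilon>)", OF pq] average_cmult_right average_add average_const)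
  then have "(\<lambda>n. complex_of_real c * (average (H n) (apply_bcontfun q) + complex_of_real s)) \<longlonglongrightarrow> 1"
    using trig_polys_mean(1)[OF H p(1)] p(2) by simp
  moreover have "(\<lambda>n. complex_of_real c * (average (H n) (apply_bcontfun q) + complex_of_real s)) \<longlonglongrightarrow>
      complex_of_real c * (mean H q + complex_of_real s)"
    by (intro tendsto_intros trig_polys_mean H q)
  \<comment> \<open>Since \<open>p U \<epsilon>\<close> has mean 1, the factor \<open>c\<close> is
    the inverse of the mean of \<open>q + s\<close>.\<close>
  ultimately have "complex_of_real c * (mean H q + complex_of_real s) = 1"
    using LIMSEQ_unique by blast
  then have c: "\<bar>c\<bar> * cmod (mean H q + complex_of_real s) = 1"
    by (metis norm_mult norm_of_real norm_one)
  have s': "0 \<le> s" "s \<le> \<epsilon>" using s \<epsilon> by auto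
  have "Re (mean H q - 1) \<ge> - \<epsilon>"
    using mq abs_Re_le_cmod[of "mean H q - 1"] by linarith
  \<comment> \<open>The real part of \<open>mean H q\<close> is at least
    \<open>1 - \<epsilon>\<close>, and \<open>s\<close> is non-negative.\<close>
  then have "Re (mean H q + complex_of_real s) \<ge> 1/2"
    using \<epsilon> s' by simp
  then have "cmod (mean H q + complex_of_real s) \<ge> 1/2"
    using complex_Re_le_cmod order_trans by blast
  then have "\<bar>c\<bar> * (1/2) \<le> 1"
    unfolding c[symmetric] by (rule mult_left_mono) simp
  then have c2: "\<bar>c\<bar> \<le> 2" by simp
  have "g (bohr_embed x) = 0"
    using g(2) x closure_subset[of "{x. g x \<noteq> 0}"] by auto
  then have "cmod (apply_bcontfun q x) \<le> \<epsilon>"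
    using q(2)[of x] by simp
  \<comment> \<open>One \<open>\<epsilon>\<close> comes from \<open>q\<close> and one from
    \<open>s\<close>.\<close>
  then have "cmod (apply_bcontfun q x + complex_of_real s) \<le> 2 * \<epsilon>"
    using norm_triangle_ineq[of "apply_bcontfun q x" "complex_of_real s"] s' by simp
  then have "\<bar>c\<bar> * cmod (apply_bcontfun q x + complex_of_real s) \<le> 2 * (2 * \<epsilon>)"
    using c2 by (intro mult_mono) auto
  then show ?thesis
    by (simp add: pq norm_mult)
qed

text \<open>As \<open>p U \<epsilon>\<close> has mean 1, the error is the mean of
  \<open>p U \<epsilon>\<close> at \<open>- \<gamma>\<close> times
  \<open>translate (- \<gamma>) h - h\<close>. In a small Bohr neighbourhood the second factor is
  small, and outside it the first is.\<close>

theorem bochner_fejer_approx: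
  fixes h :: "'g::{ab_group_add, discrete_topology} \<Rightarrow>\<^sub>C 'x::{complex_normed_vector, banach}"
  assumes H: "bohr_bochner H" and \<mu>: "normalized_haar \<mu>" and basis: "open_nhd_basis_0 \<U>"
    and bf: "bochner_fejer H \<mu> \<U> p" and h: "h \<in> AP" and "e > 0"
  shows "\<exists>U\<in>\<U>. \<exists>\<epsilon>\<in>{0<..<1}. norm (mean_conv H (p U \<epsilon>) h - h) \<le> e"
proof -
  obtain V where V: "open V" "0 \<in> V" "\<And>\<gamma>. bohr_embed \<gamma> \<in> V \<Longrightarrow> norm (translate \<gamma> h - h) < e/2"
    using AP_translate_near[OF h, of "e/2"] \<open>e > 0\<close> by auto
  then obtain U where U: "U \<in> \<U>" "U \<subseteq> V"
    using basis unfolding open_nhd_basis_0_def by blast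
  \<comment> \<open>Chosen to give \<open>small\<close>; the summand 1 avoids division by 0, and the
    cap \<open>1/2\<close> admits \<open>bochner_fejer_small_outside\<close>.\<close>
  define \<epsilon> where "\<epsilon> = min (1/2) (e / (16 * (norm h + 1)))"
  have pos: "0 < norm h + 1"
    by (simp add: add_nonneg_pos)
  have \<epsilon>: "0 < \<epsilon>" "\<epsilon> \<le> 1/2"
    using \<open>e > 0\<close> pos unfolding \<epsilon>_def by (simp, intro min.cobounded1)
  then have \<epsilon>1: "\<epsilon> \<in> {0<..<1}" by simp
  have "\<epsilon> * (16 * (norm h + 1)) \<le> e"
    using pos pos_le_divide_eq[of "16 * (norm h + 1)" \<epsilon> e] by (simp add: \<epsilon>_def)
  then have small: "4 * \<epsilon> * (2 * norm h) \<le> e/2"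
    using \<epsilon>(1) by (simp add: algebra_simps)
  let ?P = "apply_bcontfun (p U \<epsilon>)"
  have nonneg: "?P \<gamma> \<in> \<real>\<^sub>\<ge>\<^sub>0" for \<gamma>
    using bf U(1) \<epsilon>1 unfolding bochner_fejer_def by blast
  have mean1: "mean H (p U \<epsilon>) = 1" and trig: "p U \<epsilon> \<in> trig_polys"
    using bf U(1) \<epsilon>1 unfolding bochner_fejer_def by blast+
  have P: "?P \<gamma> = complex_of_real (Re (?P \<gamma>))" "cmod (?P \<gamma>) = Re (?P \<gamma>)" for \<gamma>
    using nonneg[of \<gamma>] by (auto simp: nonneg_Reals_def)
  \<comment> \<open>Adding the bounds of the two cases gives one valid at every
    \<open>\<gamma>\<close>, ready to be averaged. The first term then tends to \<open>e/2\<close>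
    because the mean is 1.\<close>
  have bound: "norm (?P (- \<gamma>) *\<^sub>C (translate (- \<gamma>) h - h)) \<le> e/2 * Re (?P (- \<gamma>)) + e/2" for \<gamma>
  proof (cases "bohr_embed (- \<gamma>) \<in> U")
    case True
    then have "norm (translate (- \<gamma>) h - h) \<le> e/2"
      using U V(3) by (meson less_imp_le subsetD)
    then have "Re (?P (- \<gamma>)) * norm (translate (- \<gamma>) h - h) \<le> Re (?P (- \<gamma>)) * (e/2)"
      by (rule mult_left_mono) (metis P(2) norm_ge_zero)
    then show ?thesis
      using \<open>e > 0\<close> by (simp add: norm_scaleC P(2) mult.commute)
  next
    case False
    have "norm (translate (- \<gamma>) h - h) \<le> 2 * norm h"
      using norm_triangle_ineq4[of "translate (- \<gamma>) h" h] norm_translate_le[of "- \<gamma>" h] by linarith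
    then have "cmod (?P (- \<gamma>)) * norm (translate (- \<gamma>) h - h) \<le> 4 * \<epsilon> * (2 * norm h)"
      using bochner_fejer_small_outside[OF H \<mu> bf U(1) \<epsilon>(1,2) False] \<epsilon>(1) by (intro mult_mono) auto
    moreover have "0 \<le> e/2 * Re (?P (- \<gamma>))"
      using \<open>e > 0\<close> by (metis P(2) divide_nonneg_nonneg less_imp_le mult_nonneg_nonneg norm_ge_zero zero_le_numeral)
    ultimately show ?thesis
      using small by (simp add: norm_scaleC)
  qed
  have fin: "finite (H n)" "H n \<noteq> {}" for n
    using H by (auto simp: bohr_bochner_def)
  have "norm (conv_average (H n) (p U \<epsilon>) h - average (H n) (\<lambda>\<gamma>. ?P (- \<gamma>)) *\<^sub>C h) \<le>
      e/2 * Re (average (H n) (\<lambda>\<gamma>. ?P (- \<gamma>))) + e/2" for n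
  proof -
    have "conv_average (H n) (p U \<epsilon>) h - average (H n) (\<lambda>\<gamma>. ?P (- \<gamma>)) *\<^sub>C h =
        average (H n) (\<lambda>\<gamma>. ?P (- \<gamma>) *\<^sub>C (translate (- \<gamma>) h - h))"
      by (simp add: conv_average_def bounded_bilinear.diff_right[OF bounded_bilinear_scaleC] average_diff average_scaleC_left)
    also have "norm \<dots> \<le> average (H n) (\<lambda>\<gamma>. e/2 * Re (?P (- \<gamma>)) + e/2)"
      by (rule norm_average_le_average[OF bound])
    also have "\<dots> = e/2 * average (H n) (\<lambda>\<gamma>. Re (?P (- \<gamma>))) + e/2"
      by (simp only: average_add average_cmult_right average_const[OF fin])
    also have "average (H n) (\<lambda>\<gamma>. Re (?P (- \<gamma>))) = Re (average (H n) (\<lambda>\<gamma>. ?P (- \<gamma>)))"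
      by (rule average_linear[OF bounded_linear.linear[OF bounded_linear_Re]])
    finally show ?thesis .
  qed
  moreover have "(\<lambda>n. norm (conv_average (H n) (p U \<epsilon>) h - average (H n) (\<lambda>\<gamma>. ?P (- \<gamma>)) *\<^sub>C h)) \<longlonglongrightarrow>
      norm (mean_conv H (p U \<epsilon>) h - mean H (p U \<epsilon>) *\<^sub>C h)"
    by (intro tendsto_intros bounded_bilinear.tendsto[OF bounded_bilinear_scaleC] trig_polys_mean
        conv_average_tendsto H h trig)
  moreover have "(\<lambda>n. e/2 * Re (average (H n) (\<lambda>\<gamma>. ?P (- \<gamma>))) + e/2) \<longlonglongrightarrow> e/2 * Re (mean H (p U \<epsilon>)) + e/2"
    by (intro tendsto_intros trig_polys_mean H trig)
  ultimately have "norm (mean_conv H (p U \<epsilon>) h - mean H (p U \<epsilon>) *\<^sub>C h) \<le> e/2 * Re (mean H (p U \<epsilon>)) + e/2"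
    by (intro LIMSEQ_le[of "\<lambda>n. norm (conv_average (H n) (p U \<epsilon>) h - average (H n) (\<lambda>\<gamma>. ?P (- \<gamma>)) *\<^sub>C h)"]) auto
  then show ?thesis
    using U(1) \<epsilon>1 by (intro bexI[of _ U] bexI[of _ \<epsilon>]) (simp_all add: mean1)
qed

section \<open>Intertwiners\<close>

lemma linear_twist: "linear (twist \<tau>)"
  and twist_scaleC: "twist \<tau> (c *\<^sub>C f) = c *\<^sub>C twist \<tau> f"
  and norm_twist: "norm (twist \<tau> f) = norm f"
proof -
  have lin: "clinear_op (apply_unitary A)" for A :: "'b unitary"
    using apply_unitary[of A] by blast
  show "linear (twist \<tau>)"
    using lin by (intro linearI bcontfun_eqI) (simp_all add: twist.rep_eq clinear_op_def scaleR_scaleC scaleC_bcontfun.rep_eq)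
  show "twist \<tau> (c *\<^sub>C f) = c *\<^sub>C twist \<tau> f"
    using lin by (intro bcontfun_eqI) (simp_all add: twist.rep_eq clinear_op_def scaleC_bcontfun.rep_eq)
  show "norm (twist \<tau> f) = norm f"
    by (simp add: norm_bcontfun_def dist_bcontfun_def twist.rep_eq norm_apply_unitary)
qed

text \<open>The twist is isometric, hence injective, so the inverse inside
  \<open>twisted_translate\<close> cancels on twisted functions and only plain translations
  remain.\<close>

lemma intertwiner_translate:
  assumes "intertwiner (twisted_translate \<tau>) translate C"
  shows "C (twist \<tau> (translate \<gamma> f)) = translate \<gamma> (C (twist \<tau> f))"
proof -
  have "inj (twist \<tau>)"
    unfolding linear_injective_0[OF linear_twist] by (metis norm_eq_zero norm_twist)
  moreover have "C (twisted_translate \<tau> \<gamma> (twist \<tau> f)) = translate \<gamma> (C (twist \<tau> f))"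
    using assms unfolding intertwiner_def by (metis comp_apply)
  ultimately show ?thesis
    by (simp add: twisted_translate_def)
qed

theorem lemma4p7:
  fixes H :: "nat \<Rightarrow> 'g::{ab_group_add, countable, discrete_topology} set"
    and \<tau> :: "'g \<Rightarrow> 'x::fin_dim_chilbert unitary"
    and h :: "'g \<Rightarrow>\<^sub>C 'x"
    and C :: "('g \<Rightarrow>\<^sub>C 'x) \<Rightarrow> ('g \<Rightarrow>\<^sub>C 'y::fin_dim_chilbert)"
    and \<mu> :: "'g bohr measure"
    and \<U> :: "'g bohr set set"
    and p :: "'g bohr set \<Rightarrow> real \<Rightarrow> ('g \<Rightarrow>\<^sub>C complex)"
  assumes "bohr_bochner H"
    and "normalized_haar \<mu>"
    and "open_nhd_basis_0 \<U>"
    and "bochner_fejer H \<mu> \<U> p"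
    and "unitary_rep \<tau>"
    and "h \<in> AP"
    and "intertwiner (twisted_translate \<tau>) translate C"
  shows "(C (twist \<tau> h) = 0
            \<longleftrightarrow> (\<forall>\<psi>. C (twist \<tau> (\<psi> \<otimes>\<^sub>c fourier_coeff H h \<psi>)) = 0))
       \<and> ((\<forall>\<psi>. C (twist \<tau> (\<psi> \<otimes>\<^sub>c fourier_coeff H h \<psi>)) = 0)
            \<longleftrightarrow> (\<forall>U\<in>\<U>. \<forall>\<epsilon>\<in>{0<..<1}. C (twist \<tau> (mean_conv H (p U \<epsilon>) h)) = 0))"
proof -
  note H = \<open>bohr_bochner H\<close> and h = \<open>h \<in> AP\<close>
  define D where "D f = C (twist \<tau> f)" for f
  have C: "clinear_op C" and "\<exists>K. \<forall>x. norm (C x) \<le> norm x * K"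
    using assms(7) by (auto simp: intertwiner_def bounded_clinear_def)
  then obtain K where K: "\<And>f. norm (D f) \<le> norm f * K"
    by (metis D_def norm_twist)
  have D_add: "D (f + g) = D f + D g" and D_scaleC: "D (c *\<^sub>C f) = c *\<^sub>C D f" for f g c
    using C by (simp_all add: D_def clinear_op_def linear_add[OF linear_twist] twist_scaleC)
  have "bounded_linear D"
    using K by (intro bounded_linear_intro[where K=K]) (simp_all add: D_add D_scaleC scaleR_scaleC)
  note D_tendsto = bounded_linear.tendsto[OF this] and D_linear = bounded_linear.linear[OF this]
  have D_translate: "D (translate \<gamma> f) = translate \<gamma> (D f)" for \<gamma> f
    unfolding D_def by (rule intertwiner_translate[OF assms(7)])
  have i_ii: "D (\<psi> \<otimes>\<^sub>c fourier_coeff H h \<psi>) = 0" if "D h = 0" for \<psi>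
  proof -
    \<comment> \<open>The average is a finite combination of translates of \<open>h\<close>, and
      \<open>D\<close> maps each of these to a translate of 0.\<close>
    have "D (fourier_average (H n) \<psi> h) = 0" for n
      by (simp add: fourier_average_def D_scaleC D_translate that linear_0[OF linear_translate]
          bounded_bilinear.zero_right[OF bounded_bilinear_scaleC] flip: average_linear[OF D_linear])
    then show ?thesis
      using D_tendsto[OF fourier_average_tendsto[OF H h], of \<psi>] by (simp add: LIMSEQ_const_iff)
  qed
  \<comment> \<open>The kernel of \<open>D\<close> is a complex subspace and plays the part of
    \<open>W\<close>.\<close>
  have ii_iii: "D (mean_conv H (p U \<epsilon>) h) = 0"
    if "\<And>\<psi>. D (\<psi> \<otimes>\<^sub>c fourier_coeff H h \<psi>) = 0" "U \<in> \<U>" "\<epsilon> \<in> {0<..<1}" for U \<epsilon>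
    using mean_conv_mem[OF H h bochner_fejer_trig_polys[OF assms(4) that(2,3)], of "{f. D f = 0}"] that(1)
    by (simp add: D_add D_scaleC bounded_bilinear.zero_right[OF bounded_bilinear_scaleC])
  have iii_i: "D h = 0" if iii: "\<And>U \<epsilon>. U \<in> \<U> \<Longrightarrow> \<epsilon> \<in> {0<..<1} \<Longrightarrow> D (mean_conv H (p U \<epsilon>) h) = 0"
  proof -
    \<comment> \<open>The kernel is closed, so it is enough to approximate \<open>h\<close> by mean
      convolutions, which lie in it.\<close>
    define S where "S = {f. D f = 0}"
    have "closed S"
      unfolding S_def using \<open>bounded_linear D\<close>
      by (intro closed_Collect_eq continuous_on_const linear_continuous_on)
    moreover have "h \<in> closure S"
      unfolding closure_approachable
    proof (intro allI impI)
      fix e :: real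
      assume "e > 0"
      then obtain U \<epsilon> where "U \<in> \<U>" "\<epsilon> \<in> {0<..<1}" "norm (mean_conv H (p U \<epsilon>) h - h) \<le> e/2"
        using bochner_fejer_approx[OF assms(1-4) h, of "e/2"] by auto
      then show "\<exists>y\<in>S. dist y h < e"
        using \<open>e > 0\<close> iii by (intro bexI[of _ "mean_conv H (p U \<epsilon>) h"]) (auto simp: S_def dist_norm)
    qed
    ultimately show ?thesis
      by (simp add: S_def)
  qed
  show ?thesis
    unfolding D_def[symmetric] using i_ii ii_iii iii_i by blast
qed

end
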